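(* Let $c$ be a positive integer. (a) The lattice $\mathbb{Z}^2$, and likewise $\mathbb{Z}^6$, has a multiplier of norm $c$ if and only if $c=r^2+s^2$ for some $r,s\in\mathbb{Z}$, i.e. if and only if every prime $\equiv 3\pmod 4$ appears to an even power in $c$. (b) The root lattice $A_2$, and likewise $E_6$, has a multiplier of norm $c$ if and only if $c=r^2-rs+s^2$ for some $r,s\in\mathbb{Z}$, i.e. if and only if every prime $\equiv 2\pmod 3$ appears to an even power in $c$. (c) The root lattice $A_4$ has a multiplier of norm $c$ if and only if $c=r^2+rs-s^2$ for some $r,s\in\mathbb{Z}$, i.e. if and only if every prime $\equiv\pm 2\pmod 5$ appears to an even power in $c$.
   Context: A similarity of norm $c$ is a linear map $\sigma:\mathbb{R}^n\to\mathbb{R}^n$ with $\sigma u\cdot\sigma v=c\,u\cdot v$ for all $u,v$. A multiplier of norm $c$ for a lattice $\Lambda$ is a similarity $\sigma$ of norm $c$ with $\sigma(\Lambda)\subseteq\Lambda$. $A_2,A_4,E_6$ are the standard root lattices. *)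

theory Defs
  imports "HOL-Analysis.Analysis" "HOL-Number_Theory.Number_Theory"
begin

text \<open>
  Root lattices are given in their usual coordinates and so need not span the ambient space.
  Similarities therefore live on a subspace \<open>E\<close>, which is the Euclidean space spanned by
  the lattice; values of \<open>\<sigma>\<close> outside \<open>E\<close> are irrelevant.
\<close>

definition similarity_on :: "'a::euclidean_space set \<Rightarrow> real \<Rightarrow> ('a \<Rightarrow> 'a) \<Rightarrow> bool" where
  "similarity_on E c \<sigma> \<longleftrightarrow>
     \<sigma> ` E \<subseteq> E \<and>
     (\<forall>u\<in>E. \<forall>v\<in>E. \<sigma> (u + v) = \<sigma> u + \<sigma> v) \<and>
     (\<forall>a. \<forall>u\<in>E. \<sigma> (a *\<^sub>R u) = a *\<^sub>R \<sigma> u) \<and>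
     (\<forall>u\<in>E. \<forall>v\<in>E. \<sigma> u \<bullet> \<sigma> v = c * (u \<bullet> v))"

lemma similarity_on_UNIV:
  "similarity_on UNIV c \<sigma> \<longleftrightarrow> linear \<sigma> \<and> (\<forall>u v. \<sigma> u \<bullet> \<sigma> v = c * (u \<bullet> v))"
  by (auto simp: similarity_on_def linear_iff)

definition multiplier :: "'a::euclidean_space set \<Rightarrow> real \<Rightarrow> ('a \<Rightarrow> 'a) \<Rightarrow> bool" where
  "multiplier \<Lambda> c \<sigma> \<longleftrightarrow> similarity_on (span \<Lambda>) c \<sigma> \<and> \<sigma> ` \<Lambda> \<subseteq> \<Lambda>"

definition has_multiplier :: "'a::euclidean_space set \<Rightarrow> real \<Rightarrow> bool" where
  "has_multiplier \<Lambda> c \<longleftrightarrow> (\<exists>\<sigma>. multiplier \<Lambda> c \<sigma>)"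

definition integer_lattice :: "(real ^ 'n) set" where
  "integer_lattice = {x. \<forall>i. x $ i \<in> \<int>}"

abbreviation Z2_lattice :: "(real ^ 2) set" where "Z2_lattice \<equiv> integer_lattice"

abbreviation Z6_lattice :: "(real ^ 6) set" where "Z6_lattice \<equiv> integer_lattice"

text \<open>In \<open>real ^ 'n\<close> this is the root lattice of type A with rank \<open>CARD('n) - 1\<close>.\<close>

definition A_lattice :: "(real ^ 'n) set" where
  "A_lattice = {x \<in> integer_lattice. (\<Sum>i\<in>UNIV. x $ i) = 0}"

abbreviation A2_lattice :: "(real ^ 3) set" where "A2_lattice \<equiv> A_lattice"

abbreviation A4_lattice :: "(real ^ 5) set" where "A4_lattice \<equiv> A_lattice"

definition E8_lattice :: "(real ^ 8) set" where
  "E8_lattice = {x. ((\<forall>i. x $ i \<in> \<int>) \<or> (\<forall>i. x $ i - 1/2 \<in> \<int>)) \<and>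
                    (\<Sum>i\<in>UNIV. x $ i) / 2 \<in> \<int>}"

text \<open>
  The orthogonal complement in the \<open>E\<^sub>8\<close> lattice of the \<open>A\<^sub>2\<close> sublattice generated by
  \<open>e\<^sub>6 - e\<^sub>7\<close> and \<open>e\<^sub>7 - e\<^sub>8\<close>. As an index of type \<open>8\<close>, the numeral \<open>8\<close> equals \<open>0\<close>;
  it is distinct from \<open>1, \<dots>, 7\<close>.
\<close>

definition E6_lattice :: "(real ^ 8) set" where
  "E6_lattice = {x \<in> E8_lattice. x $ 6 = x $ 7 \<and> x $ 7 = x $ 8}"

end

theory Submission
  imports Defs
begin

text \<open>
  The quadratic forms are the norm forms of \<open>\<int>[i]\<close>, \<open>\<int>[\<omega>]\<close> and the ring of integers of \<open>\<rat>(\<surd>5)\<close>;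
  they represent \<open>c\<close> iff all inert primes divide \<open>c\<close> to an even power, by descent at the inert
  primes and Thue's lemma at the others.

  Necessity. Let \<open>\<sigma>\<close> have nonsquare norm \<open>c\<close> on a rational space of dimension \<open>2k\<close>. Choose \<open>y\<close> and put
  \<open>x = \<sigma> y\<close>. Composing \<open>\<sigma>\<close> with the reflection in \<open>\<sigma> x - c y\<close> gives a similarity of norm \<open>c\<close> that
  maps \<open>y\<close> to \<open>x\<close> and \<open>x\<close> to \<open>c y\<close>, so it preserves the plane of \<open>x\<close> and \<open>y\<close> and its complement. The
  Gram determinant of this plane is minus a norm from \<open>\<rat>(\<surd>c)\<close>. By induction the determinant \<open>d\<close> of the
  space is, up to squares, \<open>(-1)^k\<close> times such a norm, whence \<open>c\<close> is a norm from \<open>\<rat>(\<surd>((-1)^k d))\<close>.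

  Sufficiency. For all lattices but \<open>A\<^sub>4\<close> an isometry of order 4 or 3 without fixed vectors makes the
  lattice a module over \<open>\<int>[i]\<close> or \<open>\<int>[\<omega>]\<close>. For \<open>A\<^sub>4\<close> it suffices to treat an odd prime \<open>p\<close> modulo which 5 is
  a square. Then \<open>A\<^sub>4\<close> modulo \<open>p\<close> has a totally isotropic plane, whose preimage, scaled by \<open>1/\<surd>p\<close>, is an
  even lattice of determinant 5. Lattice reduction shows that such a lattice contains a copy of \<open>A\<^sub>4\<close>.
\<close>

section \<open>Representation of integers by norm forms\<close>

text \<open>The norm of \<open>r + s * \<theta>\<close>, where
  \<open>\<theta>\<^sup>2 = b * \<theta> - e\<close>. The pairs \<open>(b, e)\<close> used below are
  \<open>(0, 1)\<close> for \<open>i\<close>, \<open>(-1, 1)\<close> for a primitive cube root of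
  unity \<omega>, and \<open>(1, -1)\<close> for the golden ratio.\<close>

definition binform :: "int \<Rightarrow> int \<Rightarrow> int \<Rightarrow> int \<Rightarrow> int" where
  "binform b e r s = r\<^sup>2 + b * (r * s) + e * s\<^sup>2"

text \<open>The polynomial is the minimal polynomial of \<open>- \<theta>\<close>; having no root
  modulo \<open>p\<close> means that \<open>p\<close> stays prime in the ring generated by \<theta>.
  This form treats \<open>p = 2\<close> like all other primes.\<close>

definition inert :: "int \<Rightarrow> int \<Rightarrow> nat \<Rightarrow> bool" where
  "inert b e p \<longleftrightarrow> prime p \<and> (\<forall>a::int. \<not> int p dvd a\<^sup>2 + b * a + e)"

text \<open>Norms multiply: the arguments on the right are the coordinates of
  \<open>(r + s * \<theta>) * (u + v * \<theta>)\<close>.\<close>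

lemma binform_mult:
  "binform b e r s * binform b e u v = binform b e (r * u - e * (s * v)) (r * v + s * u + b * (s * v))"
  unfolding binform_def by (simp add: algebra_simps power2_eq_square)

text \<open>If \<open>s\<close> were invertible modulo \<open>p\<close>, then \<open>r / s\<close>
  would be a root of the polynomial that \<open>inert\<close> excludes.\<close>

lemma inert_dvd_binform:
  assumes "inert b e p" "int p dvd binform b e r s"
  shows "int p dvd r" "int p dvd s"
proof -
  have p: "prime (int p)" using assms(1) by (simp add: inert_def)
  show s: "int p dvd s"
  proof (rule ccontr)
    assume "\<not> int p dvd s"
    then have "coprime s (int p)" using p by (metis coprime_commute prime_imp_coprime)
    then obtain t where t: "[s * t = 1] (mod int p)" using cong_solve_coprime_int by blast
    have "(r*t)\<^sup>2 + b * (r*t) + e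
       = t\<^sup>2 * binform b e r s + b * r * t * (1 - s*t) + e * (1 - (s*t)) * (1 + s*t)"
      unfolding binform_def by (simp add: algebra_simps power2_eq_square)
    moreover have "int p dvd 1 - s*t" using t by (simp add: cong_iff_dvd_diff dvd_diff_commute)
    ultimately have "int p dvd (r*t)\<^sup>2 + b * (r*t) + e" using assms(2) by simp
    then show False using assms(1) by (simp add: inert_def)
  qed
  have "r\<^sup>2 = binform b e r s - s * (b * r + e * s)"
    unfolding binform_def by (simp add: algebra_simps power2_eq_square)
  then have "int p dvd r\<^sup>2" using s assms(2) by simp
  then show "int p dvd r" using p prime_dvd_power by blast
qed

text \<open>Infinite descent on \<open>c * y\<^sup>2\<close>. The factor \<open>y\<^sup>2\<close> is
  there because a rational norm equation determines \<open>c\<close> only up to squares.\<close>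

lemma even_multiplicity_of_binform:
  assumes "inert b e p" "c > 0" "int c * y\<^sup>2 = binform b e r s" "y \<noteq> 0"
  shows "even (multiplicity p c)"
  using assms(2-)
proof (induction "nat (int c * y\<^sup>2)" arbitrary: c y r s rule: less_induct)
  case less
  have p: "prime p" using assms(1) by (simp add: inert_def)
  have p1: "p > 1" using p prime_gt_1_nat by blast
  show ?case
  proof (cases "p dvd c")
    case False
    then show ?thesis by (simp add: not_dvd_imp_multiplicity_0)
  next
    case True
    then have "int p dvd binform b e r s" using less.prems(2) by (metis dvd_mult2 int_dvd_int_iff)
    then obtain r' s' where rs: "r = int p * r'" "s = int p * s'"
      using inert_dvd_binform[OF assms(1)] by (meson dvdE)
    have f: "binform b e r s = (int p)\<^sup>2 * binform b e r' s'"
      unfolding rs binform_def by (simp add: algebra_simps power2_eq_square)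
    have pos: "0 < int c * y\<^sup>2" using less.prems(1,3) by simp
    \<comment> \<open>The factor \<open>p\<^sup>2\<close> of the right-hand side is cancelled from
      \<open>y\<^sup>2\<close> if \<open>p\<close> divides \<open>y\<close>, and from
      \<open>c\<close> otherwise; only the latter changes the multiplicity, by two.\<close>
    show ?thesis
    proof (cases "int p dvd y")
      case True
      then obtain y' where y': "y = int p * y'" by blast
      have eq: "int c * y'\<^sup>2 = binform b e r' s'"
        using f less.prems(2) p1 by (simp add: y' power_mult_distrib)
      have "y' \<noteq> 0" using less.prems y' by auto
      moreover have "int c * y'\<^sup>2 < int c * y\<^sup>2"
        using p1 \<open>y' \<noteq> 0\<close> less.prems(1) y' by (simp add: power_mult_distrib)
      ultimately show ?thesis
        using less.hyps[OF _ less.prems(1) eq] pos by (simp add: nat_less_eq_zless)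
    next
      case False
      then have "coprime ((int p)\<^sup>2) (y\<^sup>2)"
        using p by (simp add: prime_imp_coprime)
      moreover have "(int p)\<^sup>2 dvd int c * y\<^sup>2" using f less.prems(2) by simp
      ultimately have "(int p)\<^sup>2 dvd int c" by (simp add: coprime_dvd_mult_left_iff)
      then have "p\<^sup>2 dvd c" by (metis int_dvd_int_iff of_nat_power)
      then obtain c' where c': "c = p\<^sup>2 * c'" by blast
      have c'0: "c' > 0" using less.prems(1) c' by (cases c') auto
      have eq: "int c' * y\<^sup>2 = binform b e r' s'"
        using f less.prems(2) p1 by (simp add: c')
      have "int c' * y\<^sup>2 < int c * y\<^sup>2"
        using p1 c'0 less.prems(3) c' by simp
      then have "even (multiplicity p c')"
        using less.hyps[OF _ c'0 eq less.prems(3)] pos by (simp add: nat_less_eq_zless)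
      moreover have "multiplicity p c = 2 + multiplicity p c'"
        unfolding c' using p c'0 by (simp add: prime_elem_multiplicity_mult_distrib prime_elem_multiplicity_power_distrib)
      ultimately show ?thesis by simp
    qed
  qed
qed

text \<open>Splitting off a non-inert prime, or the square of an inert one, leaves a smaller number
  of the same kind. The rule serves both the norm forms and the multipliers of
  \<open>A4_lattice\<close>.\<close>

lemma induct_inert_even:
  assumes "\<And>p. inert b e p \<Longrightarrow> even (multiplicity p c)" "c > 0"
    and one: "P 1"
    and mult: "\<And>m n. P m \<Longrightarrow> P n \<Longrightarrow> P (m * n)"
    and split: "\<And>p. prime p \<Longrightarrow> \<not> inert b e p \<Longrightarrow> P p"
    and sq: "\<And>p. prime p \<Longrightarrow> P (p\<^sup>2)"
  shows "P (c::nat)"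
  using assms(1,2)
proof (induction c rule: less_induct)
  case (less c)
  show ?case
  proof (cases "c = 1")
    case False
    then obtain p where p: "prime p" "p dvd c" using prime_factor_nat by blast
    have p1: "p > 1" using p prime_gt_1_nat by blast
    show ?thesis
    proof (cases "inert b e p")
      case False
      obtain c' where c': "c = p * c'" using p by blast
      have c'0: "c' > 0" using less.prems(2) c' by (cases c') auto
      have "even (multiplicity q c')" if "inert b e q" for q
      proof -
        have "q \<noteq> p" "prime q" using that False by (auto simp: inert_def)
        then have "multiplicity q c = multiplicity q c'"
          using p(1) c'0 by (simp add: c' prime_elem_multiplicity_mult_distrib prime_multiplicity_other)
        then show ?thesis using less.prems(1)[OF that] by simp
      qed
      then have "P c'" using less.IH[of c'] c'0 c' p1 by simp
      then show ?thesis unfolding c' using mult split p(1) False by blast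
    next
      case True
      have "multiplicity p c > 0"
        using p less.prems(2) by (simp add: prime_multiplicity_gt_zero_iff)
      then have "multiplicity p c \<ge> 2" using less.prems(1)[OF True] by presburger
      then have "p\<^sup>2 dvd c" by (rule multiplicity_dvd')
      then obtain c' where c': "c = p\<^sup>2 * c'" by blast
      have c'0: "c' > 0" using less.prems(2) c' by (cases c') auto
      have "even (multiplicity q c')" if "inert b e q" for q
      proof -
        have "prime q" using that by (auto simp: inert_def)
        then have "multiplicity q c = multiplicity q (p\<^sup>2) + multiplicity q c'"
          using p(1) c'0 by (simp add: c' prime_elem_multiplicity_mult_distrib)
        moreover have "even (multiplicity q (p\<^sup>2))"
          using \<open>prime q\<close> p(1) by (simp add: prime_elem_multiplicity_power_distrib)
        ultimately show ?thesis using less.prems(1)[OF that] by simp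
      qed
      moreover have "c' < c" using c'0 c' p1 one_less_power[of p 2] by simp
      ultimately have "P c'" using less.IH[of c'] c'0 by blast
      then show ?thesis unfolding c' using mult sq p(1) by blast
    qed
  qed (use one in simp)
qed

section \<open>Thue's lemma and the representation of non-inert primes\<close>

text \<open>Pigeonhole: for \<open>k = floor_sqrt p\<close> there are more than \<open>p\<close>
  pairs with entries up to \<open>k\<close>, so two of them share the residue of
  \<open>x - a * y\<close>; \<open>r\<close> and \<open>s\<close> are the differences of their
  entries.\<close>

lemma thue:
  fixes p :: nat and a :: int
  assumes "prime p"
  shows "\<exists>r s::int. (r \<noteq> 0 \<or> s \<noteq> 0) \<and> int p dvd r - a * s \<and> r\<^sup>2 < int p \<and> s\<^sup>2 < int p"
proof -
  define k where "k = floor_sqrt p"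
  define f where "f = (\<lambda>(x::nat, y::nat). (int x - a * int y) mod int p)"
  have p0: "p > 0" using assms prime_gt_0_nat by blast
  have "card ({..k} \<times> {..k}) = (Suc k)\<^sup>2" by (simp add: power2_eq_square)
  moreover have "p < (Suc k)\<^sup>2" unfolding k_def by (rule Suc_floor_sqrt_power2_gt)
  moreover have "card (f ` ({..k} \<times> {..k})) \<le> card {0..<int p}"
    by (rule card_mono) (use p0 in \<open>auto simp: f_def\<close>)
  ultimately have "\<not> inj_on f ({..k} \<times> {..k})"
    by (intro pigeonhole) simp
  then obtain x y x' y' where xy: "x \<le> k" "y \<le> k" "x' \<le> k" "y' \<le> k" "(x, y) \<noteq> (x', y')"
    "f (x, y) = f (x', y')" unfolding inj_on_def by auto
  \<comment> \<open>The bound is strict because a prime is not a square.\<close>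
  have ksq: "z\<^sup>2 < int p" if "\<bar>z\<bar> \<le> int k" for z
  proof -
    have "k\<^sup>2 \<le> p" unfolding k_def by simp
    moreover have "k\<^sup>2 \<noteq> p" using assms by (auto simp: prime_power_iff)
    ultimately have "int (k\<^sup>2) < int p" by (simp del: of_nat_power)
    then have "(int k)\<^sup>2 < int p" by (simp only: of_nat_power)
    moreover have "z\<^sup>2 \<le> (int k)\<^sup>2" using that by (metis abs_le_square_iff abs_of_nat)
    ultimately show ?thesis by (rule le_less_trans[rotated])
  qed
  let ?r = "int x - int x'" and ?s = "int y - int y'"
  have "int p dvd (int x - a * int y) - (int x' - a * int y')"
    using xy(6) by (simp add: f_def mod_eq_dvd_iff)
  then have "int p dvd ?r - a * ?s" by (simp add: algebra_simps)
  moreover have "?r \<noteq> 0 \<or> ?s \<noteq> 0" using xy(5) by auto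
  moreover have "?r\<^sup>2 < int p" "?s\<^sup>2 < int p" using xy by (auto intro!: ksq)
  ultimately show ?thesis by blast
qed

lemma split_small_binform:
  assumes "prime p" "\<not> inert b e p"
  shows "\<exists>r s. (r \<noteq> 0 \<or> s \<noteq> 0) \<and> int p dvd binform b e r s \<and> r\<^sup>2 < int p \<and> s\<^sup>2 < int p"
proof -
  obtain a where a: "int p dvd a\<^sup>2 + b * a + e" using assms by (auto simp: inert_def)
  obtain r s where rs: "r \<noteq> 0 \<or> s \<noteq> 0" "int p dvd r - a * s" "r\<^sup>2 < int p" "s\<^sup>2 < int p"
    using thue[OF assms(1)] by metis
  have "binform b e r s = (r - a * s) * (r + a * s + b * s) + s\<^sup>2 * (a\<^sup>2 + b * a + e)"
    unfolding binform_def by (simp add: algebra_simps power2_eq_square)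
  then have "int p dvd binform b e r s" using rs(2) a by simp
  then show ?thesis using rs by blast
qed

lemma inert_2: "inert (-1) 1 2" "inert 1 (-1) 2"
  unfolding inert_def by (auto simp: power2_eq_square)

lemma abs_mult_less_of_squares:
  fixes r s :: int
  assumes "r\<^sup>2 < n" "s\<^sup>2 < n"
  shows "\<bar>r * s\<bar> < n"
proof -
  have "0 \<le> (r - s)\<^sup>2" "0 \<le> (r + s)\<^sup>2" by simp_all
  then show ?thesis using assms by (simp add: power2_eq_square algebra_simps abs_if)
qed

lemma dvd_between:
  fixes p x :: int
  assumes "p dvd x" "- p < x" "x < 2 * p" "x \<noteq> 0"
  shows "x = p"
proof -
  obtain k where k: "x = p * k" using assms(1) by blast
  have "p > 0" using assms by linarith
  have "p * (-1) < p * k" "p * k < p * 2" using assms unfolding k by (simp_all add: mult.commute)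
  then have "-1 < k" "k < 2" using mult_less_cancel_left_pos[OF \<open>p > 0\<close>] by blast+
  moreover have "k \<noteq> 0" using assms k by auto
  ultimately have "k = 1" by linarith
  then show ?thesis using k by simp
qed

lemma binform_pos:
  assumes "r \<noteq> 0 \<or> s \<noteq> 0"
  shows "binform 0 1 r s > 0" "binform (-1) 1 r s > 0"
proof -
  show "binform 0 1 r s > 0" using assms by (simp add: binform_def sum_power2_gt_zero_iff)
  have "4 * binform (-1) 1 r s = (2 * r - s)\<^sup>2 + 3 * s\<^sup>2" unfolding binform_def by (simp add: algebra_simps power2_eq_square)
  also have "\<dots> > 0"
    using assms by (cases "s = 0") (auto simp: add_nonneg_pos)
  finally show "binform (-1) 1 r s > 0" by simp
qed

text \<open>This form is indefinite, so positivity is of no help. But 2 is inert for it, so a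
  nontrivial zero could be halved forever.\<close>

lemma binform_golden_nonzero:
  assumes "r \<noteq> 0 \<or> s \<noteq> 0"
  shows "binform 1 (-1) r s \<noteq> 0"
  using assms
proof (induction "nat (\<bar>r\<bar> + \<bar>s\<bar>)" arbitrary: r s rule: less_induct)
  case less
  show ?case
  proof
    assume 0: "binform 1 (-1) r s = 0"
    then obtain r' s' where rs: "r = 2 * r'" "s = 2 * s'"
      using inert_dvd_binform[OF inert_2(2), of r s] by (auto elim!: dvdE)
    have "binform 1 (-1) r' s' = 0" using 0 unfolding rs binform_def by (simp add: power2_eq_square)
    moreover have "r' \<noteq> 0 \<or> s' \<noteq> 0" using less.prems rs by auto
    moreover from this have "nat (\<bar>r'\<bar> + \<bar>s'\<bar>) < nat (\<bar>r\<bar> + \<bar>s\<bar>)" unfolding rs by linarith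
    ultimately show False using less.hyps by blast
  qed
qed

text \<open>Thue's lemma yields a nonzero multiple of \<open>p\<close> among the values of the form,
  of absolute value below \<open>2 * p\<close>, or below \<open>3 * p\<close> for the second form.
  It remains to deal with the multiples \<open>2 * p\<close> and \<open>- p\<close>.\<close>

lemma split_prime_binform:
  assumes "prime p" "\<not> inert b e p" "(b, e) \<in> {(0, 1), (-1, 1), (1, -1)}"
  shows "\<exists>r s. int p = binform b e r s"
proof -
  obtain r s where rs: "r \<noteq> 0 \<or> s \<noteq> 0" "int p dvd binform b e r s" "r\<^sup>2 < int p" "s\<^sup>2 < int p"
    using split_small_binform[OF assms(1,2)] by blast
  have rs': "\<bar>r * s\<bar> < int p" using rs abs_mult_less_of_squares by blast
  have sq0: "r\<^sup>2 \<ge> 0" "s\<^sup>2 \<ge> 0" by simp_all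
  consider "b = 0" "e = 1" | "b = -1" "e = 1" | "b = 1" "e = -1" using assms(3) by auto
  then show ?thesis
  proof cases
    case 1
    have "binform b e r s = int p"
      using rs(2)
      by (rule dvd_between) (use binform_pos(1)[OF rs(1)] rs(3,4) 1 in \<open>auto simp: binform_def\<close>)
    then show ?thesis by metis
  next
    case 2
    have p2: "p \<noteq> 2" using assms(2) inert_2(1) 2 by auto
    have pos: "binform b e r s > 0" using binform_pos(2)[OF rs(1)] 2 by simp
    have lt: "binform b e r s < 3 * int p"
      using rs(3,4) rs' unfolding 2 binform_def by (auto simp: abs_if split: if_splits)
    \<comment> \<open>Only an even value can differ from \<open>p\<close>. As 2 is inert, an even
      value is four times the value at halved arguments, and the odd prime \<open>p\<close> divides
      that value too.\<close>
    show ?thesis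
    proof (cases "even (binform b e r s)")
      case True
      then obtain r' s' where rs2: "r = 2 * r'" "s = 2 * s'"
        using inert_dvd_binform[OF inert_2(1), of r s] 2 by (auto elim!: dvdE)
      have f: "binform b e r s = 4 * binform b e r' s'" unfolding rs2 2 binform_def by (simp add: algebra_simps power2_eq_square)
      have "coprime (int p) 4"
      proof -
        have "coprime (int p) 2" using p2 assms(1) primes_dvd_imp_eq[of 2 p] by auto
        then have "coprime (int p) (2 ^ 2)" unfolding coprime_power_right_iff by blast
        then show ?thesis by simp
      qed
      then have "int p dvd binform b e r' s'" using rs(2) f by (simp add: coprime_dvd_mult_right_iff)
      moreover have "0 < binform b e r' s'" "binform b e r' s' < 2 * int p" using f pos lt by auto
      ultimately have "binform b e r' s' = int p" by (intro dvd_between) auto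
      then show ?thesis by metis
    next
      case False
      obtain k where k: "binform b e r s = int p * k" using rs(2) by blast
      have "0 < k" using pos k by (simp add: zero_less_mult_iff)
      moreover have "k < 3"
        using lt unfolding k by (subst (asm) mult.commute) (simp only: mult_less_cancel_right_disj, linarith)
      moreover have "k \<noteq> 2" using False k by auto
      ultimately have "k = 1" by linarith
      then show ?thesis using k by (metis mult.right_neutral)
    qed
  next
    case 3
    have nz: "binform b e r s \<noteq> 0" using binform_golden_nonzero[OF rs(1)] 3 by simp
    have "binform b e r s = r\<^sup>2 + r * s - s\<^sup>2" by (simp add: 3 binform_def)
    then have lt: "binform b e r s < 2 * int p" "- (2 * int p) < binform b e r s"
      using rs(3,4) rs' sq0 unfolding abs_less_iff by linarith+
    show ?thesis
    proof (cases "binform b e r s > 0")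
      case True
      then have "binform b e r s = int p" using rs(2) lt nz by (intro dvd_between) auto
      then show ?thesis by metis
    next
      case False
      have "- binform b e r s = int p" using rs(2) lt nz False by (intro dvd_between) auto
      \<comment> \<open>Multiplication by the golden ratio, a unit of norm -1, takes
        \<open>r + s * \<theta>\<close> to \<open>s + (r + s) * \<theta>\<close>.\<close>
      moreover have "- binform b e r s = binform b e s (r + s)" unfolding 3 binform_def by (simp add: algebra_simps power2_eq_square)
      ultimately show ?thesis by metis
    qed
  qed
qed

lemma binform_iff_inert_even:
  assumes "(b, e) \<in> {(0, 1), (-1, 1), (1, -1)}" "c > 0"
  shows "(\<exists>r s. int c = binform b e r s) \<longleftrightarrow> (\<forall>p. inert b e p \<longrightarrow> even (multiplicity p c))"
proof
  assume "\<exists>r s. int c = binform b e r s"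
  then obtain r s where "int c * 1\<^sup>2 = binform b e r s" by auto
  then show "\<forall>p. inert b e p \<longrightarrow> even (multiplicity p c)"
    using even_multiplicity_of_binform[of b e _ c 1] assms(2) by simp
next
  assume *: "\<forall>p. inert b e p \<longrightarrow> even (multiplicity p c)"
  show "\<exists>r s. int c = binform b e r s"
  proof (rule induct_inert_even[where b = b and e = e])
    show "\<exists>r s. int 1 = binform b e r s" by (rule exI[of _ 1], rule exI[of _ 0]) (simp add: binform_def)
    show "\<exists>r s. int (p\<^sup>2) = binform b e r s" for p
      by (rule exI[of _ "int p"], rule exI[of _ 0]) (simp add: binform_def)
    show "\<exists>r s. int (m * n) = binform b e r s"
      if "\<exists>r s. int m = binform b e r s" "\<exists>r s. int n = binform b e r s" for m n
      using that by (metis binform_mult of_nat_mult)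
  qed (use * assms split_prime_binform in auto)
qed

section \<open>Inert primes in terms of congruences\<close>

text \<open>Completing the square: four times the polynomial is \<open>(2 * a + b)\<^sup>2\<close>
  minus the discriminant, and 4 is invertible modulo \<open>p\<close>.\<close>

lemma ex_square_root_shift:
  fixes b e :: int
  assumes "prime p" "p \<noteq> 2"
  shows "(\<exists>a. int p dvd a\<^sup>2 + b * a + e) \<longleftrightarrow> QuadRes (int p) (b\<^sup>2 - 4 * e)"
proof
  assume "\<exists>a. int p dvd a\<^sup>2 + b * a + e"
  then obtain a where "int p dvd a\<^sup>2 + b * a + e" by blast
  moreover have "(2*a+b)\<^sup>2 - (b\<^sup>2 - 4 * e) = 4 * (a\<^sup>2 + b * a + e)" by (simp add: algebra_simps power2_eq_square)
  ultimately have "int p dvd (2*a+b)\<^sup>2 - (b\<^sup>2 - 4 * e)" by (metis dvd_mult)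
  then have "[(2*a+b)\<^sup>2 = b\<^sup>2 - 4 * e] (mod int p)" by (simp add: cong_iff_dvd_diff)
  then show "QuadRes (int p) (b\<^sup>2 - 4 * e)" unfolding QuadRes_def by blast
next
  assume "QuadRes (int p) (b\<^sup>2 - 4 * e)"
  then obtain y where y: "int p dvd y\<^sup>2 - (b\<^sup>2 - 4 * e)" by (auto simp: QuadRes_def cong_iff_dvd_diff)
  have odd: "odd (int p)" using assms by (metis prime_odd_nat even_of_nat prime_ge_2_nat le_neq_implies_less)
  \<comment> \<open>Since \<open>p\<close> is odd, one of the representatives \<open>y\<close> and
    \<open>y + p\<close> has the parity of \<open>b\<close>.\<close>
  define a where "a = (if even (y - b) then (y - b) div 2 else (y + int p - b) div 2)"
  have "2 * a + b = y \<or> 2 * a + b = y + int p" using odd by (auto simp: a_def)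
  then have "int p dvd (2*a+b)\<^sup>2 - (b\<^sup>2 - 4 * e)"
  proof
    assume ab: "2 * a + b = y + int p"
    have "(2*a+b)\<^sup>2 - (b\<^sup>2 - 4 * e) = (y\<^sup>2 - (b\<^sup>2 - 4 * e)) + int p * (2 * y + int p)"
      unfolding ab by (simp add: algebra_simps power2_eq_square)
    then show ?thesis using y by (metis dvd_add dvd_triv_left)
  qed (use y in simp)
  moreover have "(2*a+b)\<^sup>2 - (b\<^sup>2 - 4 * e) = 2 * (2 * (a\<^sup>2 + b * a + e))" by (simp add: algebra_simps power2_eq_square)
  moreover have "coprime (int p) 2" using assms odd by simp
  ultimately have "int p dvd a\<^sup>2 + b * a + e" by (simp only: coprime_dvd_mult_right_iff)
  then show "\<exists>a. int p dvd a\<^sup>2 + b * a + e" by blast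
qed

lemma inert_gaussian_iff: "inert 0 1 p \<longleftrightarrow> prime p \<and> [p = 3] (mod 4)"
proof (cases "prime p \<and> p \<noteq> 2")
  case True
  then have p: "prime p" "2 < p" "odd p"
    using prime_ge_2_nat[of p] prime_odd_nat[of p] by auto
  have "(\<exists>a. int p dvd a\<^sup>2 + 0 * a + 1) \<longleftrightarrow> QuadRes (int p) (-1)"
    by (auto simp: QuadRes_def cong_iff_dvd_diff)
  moreover have "\<not> [-1 = 0] (mod int p)" using p by (simp add: cong_iff_dvd_diff)
  ultimately have L: "Legendre (-1) (int p) = (if inert 0 1 p then -1 else 1)"
    using p by (simp add: Legendre_def inert_def)
  have "[Legendre (-1) (int p) = (-1) ^ ((p - 1) div 2)] (mod int p)"
    using euler_criterion[OF p(1,2)] .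
  moreover have "(-1::int) ^ ((p - 1) div 2) = (if p mod 4 = 3 then -1 else 1)"
  proof (cases "p mod 4 = 3")
    case True
    then have "odd ((p - 1) div 2)" by presburger
    then show ?thesis using True by simp
  next
    case False
    then have "even ((p - 1) div 2)" using p(3) by presburger
    then show ?thesis using False by simp
  qed
  moreover have "\<not> [1 = -1] (mod int p)" "\<not> [-1 = 1] (mod int p)"
    using p by (auto simp: cong_iff_dvd_diff dest!: zdvd_imp_le)
  ultimately have "inert 0 1 p \<longleftrightarrow> p mod 4 = 3"
    using L by (auto split: if_splits)
  then show ?thesis using p by (simp add: unique_euclidean_semiring_class.cong_def)
next
  case False
  have "\<not> inert 0 1 2" unfolding inert_def by (auto intro!: exI[of _ 1])
  then show ?thesis using False by (auto simp: inert_def unique_euclidean_semiring_class.cong_def)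
qed

lemma Legendre_eq_one_iff:
  assumes "\<not> p dvd a"
  shows "Legendre a p = (if QuadRes p a then 1 else -1)"
  using assms by (simp add: Legendre_def cong_0_iff)

lemma QuadRes_3_iff: "QuadRes 3 n \<longleftrightarrow> n mod 3 \<noteq> 2"
proof
  assume "QuadRes 3 n"
  then obtain y where "y\<^sup>2 mod 3 = n mod 3" by (auto simp: QuadRes_def cong_def)
  moreover have "y mod 3 = 0 \<or> y mod 3 = 1 \<or> y mod 3 = 2" by presburger
  ultimately show "n mod 3 \<noteq> 2" using power_mod[of y 3 2] by auto
next
  assume "n mod 3 \<noteq> 2"
  then have "n mod 3 = 0 \<or> n mod 3 = 1" by presburger
  then show "QuadRes 3 n" unfolding QuadRes_def cong_def
    by (auto intro: exI[of _ 0] exI[of _ 1])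
qed

lemma QuadRes_5_iff: "QuadRes 5 n \<longleftrightarrow> n mod 5 \<noteq> 2 \<and> n mod 5 \<noteq> 3"
proof
  assume "QuadRes 5 n"
  then obtain y where "y\<^sup>2 mod 5 = n mod 5" by (auto simp: QuadRes_def cong_def)
  moreover have "y mod 5 = 0 \<or> y mod 5 = 1 \<or> y mod 5 = 2 \<or> y mod 5 = 3 \<or> y mod 5 = 4" by presburger
  ultimately show "n mod 5 \<noteq> 2 \<and> n mod 5 \<noteq> 3" using power_mod[of y 5 2] by auto
next
  assume "n mod 5 \<noteq> 2 \<and> n mod 5 \<noteq> 3"
  then have "n mod 5 = 0 \<or> n mod 5 = 1 \<or> n mod 5 = 4" by presburger
  then show "QuadRes 5 n" unfolding QuadRes_def cong_def
    by (auto intro: exI[of _ 0] exI[of _ 1] exI[of _ 2])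
qed

text \<open>Euler's criterion splits the sign \<open>(-1) ^ ((p - 1) div 2)\<close> off the Legendre
  symbol of -3, and quadratic reciprocity contributes the same sign. They cancel, which leaves the
  symbol of \<open>p\<close> modulo 3.\<close>

lemma QuadRes_minus_3_iff:
  assumes "prime p" "2 < p"
  shows "QuadRes (int p) (-3) \<longleftrightarrow> p mod 3 \<noteq> 2"
proof (cases "p = 3")
  case True
  then show ?thesis by (simp add: QuadRes_3_iff)
next
  case False
  have ndvd: "\<not> p dvd 3" "\<not> 3 dvd p"
    using primes_dvd_imp_eq[of p 3] primes_dvd_imp_eq[of 3 p] assms False by auto
  let ?k = "(p - 1) div 2"
  have "[Legendre (-3) (int p) = (-3) ^ ?k] (mod int p)" using euler_criterion[OF assms] .
  moreover have "[(-1) ^ ?k * Legendre 3 (int p) = (-1) ^ ?k * 3 ^ ?k] (mod int p)"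
    using euler_criterion[OF assms, of 3] by (rule cong_scalar_left)
  moreover have "(-1) ^ ?k * 3 ^ ?k = (-3 :: int) ^ ?k"
    by (simp flip: power_mult_distrib)
  ultimately have *: "[Legendre (-3) (int p) = (-1) ^ ?k * Legendre 3 (int p)] (mod int p)"
    by (metis cong_sym cong_trans)
  have QR: "Legendre (int p) 3 * Legendre 3 (int p) = (-1) ^ ?k"
    using Quadratic_Reciprocity[of p 3] assms False by simp
  have n3: "\<not> int p dvd 3" "\<not> int p dvd -3" "\<not> 3 dvd int p"
    using ndvd by (metis int_dvd_int_iff of_nat_numeral dvd_minus_iff)+
  have L: "Legendre 3 (int p) = 1 \<or> Legendre 3 (int p) = -1"
    by (simp add: Legendre_eq_one_iff[OF n3(1)])
  then have "(-1) ^ ?k * Legendre 3 (int p) = Legendre (int p) 3"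
    using QR by (metis mult.assoc mult_minus1_right mult.right_neutral minus_minus)
  then have *: "[Legendre (-3) (int p) = Legendre (int p) 3] (mod int p)" using * by simp
  moreover have "\<not> [1 = -1] (mod int p)" "\<not> [-1 = 1] (mod int p)"
    using assms by (auto simp: cong_iff_dvd_diff dest!: zdvd_imp_le)
  ultimately have "QuadRes (int p) (-3) \<longleftrightarrow> QuadRes 3 (int p)"
    unfolding Legendre_eq_one_iff[OF n3(2)] Legendre_eq_one_iff[OF n3(3)] by (auto split: if_splits)
  also have "\<dots> \<longleftrightarrow> p mod 3 \<noteq> 2" unfolding QuadRes_3_iff
    using zmod_int[of p 3] by auto
  finally show ?thesis .
qed

text \<open>Reciprocity between \<open>p\<close> and 5 carries no sign, since 5 is 1 modulo
  4.\<close>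

lemma QuadRes_5_prime_iff:
  assumes "prime p" "2 < p"
  shows "QuadRes (int p) 5 \<longleftrightarrow> p mod 5 \<noteq> 2 \<and> p mod 5 \<noteq> 3"
proof (cases "p = 5")
  case True
  then show ?thesis by (simp add: QuadRes_5_iff)
next
  case False
  have ndvd: "\<not> p dvd 5" "\<not> 5 dvd p"
    using primes_dvd_imp_eq[of p 5] primes_dvd_imp_eq[of 5 p] assms False by auto
  have n5: "\<not> int p dvd 5" "\<not> 5 dvd int p"
    using ndvd by (metis int_dvd_int_iff of_nat_numeral)+
  have "Legendre (int p) 5 * Legendre 5 (int p) = 1"
    using Quadratic_Reciprocity[of p 5] assms False by simp
  then have "QuadRes (int p) 5 \<longleftrightarrow> QuadRes 5 (int p)"
    unfolding Legendre_eq_one_iff[OF n5(1)] Legendre_eq_one_iff[OF n5(2)] by (auto split: if_splits)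
  also have "\<dots> \<longleftrightarrow> p mod 5 \<noteq> 2 \<and> p mod 5 \<noteq> 3" unfolding QuadRes_5_iff
    using zmod_int[of p 5] by auto
  finally show ?thesis .
qed

lemma inert_eisenstein_iff: "inert (-1) 1 p \<longleftrightarrow> prime p \<and> [p = 2] (mod 3)"
proof (cases "prime p \<and> p \<noteq> 2")
  case True
  then have "prime p" "2 < p" using prime_ge_2_nat[of p] by auto
  then show ?thesis
    using ex_square_root_shift[of p "-1" 1] QuadRes_minus_3_iff[of p]
    by (auto simp: inert_def unique_euclidean_semiring_class.cong_def)
qed (use inert_2 in \<open>auto simp: inert_def unique_euclidean_semiring_class.cong_def\<close>)

lemma inert_golden_iff:
  "inert 1 (-1) p \<longleftrightarrow> prime p \<and> ([int p = 2] (mod 5) \<or> [int p = -2] (mod 5))"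
proof -
  have cong: "[int p = 2] (mod 5) \<or> [int p = -2] (mod 5) \<longleftrightarrow> p mod 5 = 2 \<or> p mod 5 = 3"
    unfolding unique_euclidean_semiring_class.cong_def
    using zmod_int[of p 5] by auto
  show ?thesis
  proof (cases "prime p \<and> p \<noteq> 2")
    case True
    then have "prime p" "2 < p" using prime_ge_2_nat[of p] by auto
    then show ?thesis
      using ex_square_root_shift[of p 1 "-1"] QuadRes_5_prime_iff[of p] unfolding cong
      by (auto simp: inert_def)
  qed (use inert_2 cong in \<open>auto simp: inert_def\<close>)
qed

section \<open>The norm equation of a rational similarity\<close>

definition rat_vecs :: "(real ^ 'n) set" where
  "rat_vecs = {x. \<forall>i. x $ i \<in> \<rat>}"

text \<open>The complement is taken over the rationals, not the reals, because the vectors chosen in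
  it must have rational inner products.\<close>

definition rat_complement :: "(real ^ 'n) set \<Rightarrow> (real ^ 'n) set" where
  "rat_complement S = {x \<in> rat_vecs. \<forall>v\<in>S. x \<bullet> v = 0}"

lemma rat_vecs_add: "u \<in> rat_vecs \<Longrightarrow> v \<in> rat_vecs \<Longrightarrow> u + v \<in> rat_vecs"
  and rat_vecs_diff: "u \<in> rat_vecs \<Longrightarrow> v \<in> rat_vecs \<Longrightarrow> u - v \<in> rat_vecs"
  and rat_vecs_scale: "a \<in> \<rat> \<Longrightarrow> v \<in> rat_vecs \<Longrightarrow> a *\<^sub>R v \<in> rat_vecs"
  and rat_vecs_axis: "axis i 1 \<in> rat_vecs"
  by (auto simp: rat_vecs_def axis_def)

lemma Rats_sum: "(\<And>i. i \<in> A \<Longrightarrow> f i \<in> \<rat>) \<Longrightarrow> sum f A \<in> (\<rat> :: 'a :: field_char_0 set)"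
  by (induction A rule: infinite_finite_induct) auto

lemma Rats_prod: "(\<And>i. i \<in> A \<Longrightarrow> f i \<in> \<rat>) \<Longrightarrow> prod f A \<in> (\<rat> :: 'a :: field_char_0 set)"
  by (induction A rule: infinite_finite_induct) auto

lemma rat_vecs_sum: "(\<And>i. i \<in> A \<Longrightarrow> f i \<in> rat_vecs) \<Longrightarrow> sum f A \<in> rat_vecs"
  by (auto simp: rat_vecs_def intro!: Rats_sum)

lemma rat_vecs_inner: "u \<in> rat_vecs \<Longrightarrow> v \<in> rat_vecs \<Longrightarrow> u \<bullet> v \<in> \<rat>"
  by (auto simp: rat_vecs_def inner_vec_def intro!: Rats_sum)

lemma rat_complement_diff:
  "u \<in> rat_complement S \<Longrightarrow> v \<in> rat_complement S \<Longrightarrow> u - v \<in> rat_complement S"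
  and rat_complement_scale:
  "a \<in> \<rat> \<Longrightarrow> v \<in> rat_complement S \<Longrightarrow> a *\<^sub>R v \<in> rat_complement S"
  and rat_complement_inner:
  "u \<in> rat_complement S \<Longrightarrow> v \<in> rat_complement S \<Longrightarrow> u \<bullet> v \<in> \<rat>"
  by (auto simp: rat_complement_def inner_diff_left rat_vecs_diff rat_vecs_scale rat_vecs_inner)

text \<open>Gram--Schmidt over the rationals: if the complement were zero, each coordinate vector
  would equal its projection to \<open>span S\<close>, and \<open>S\<close> would span the whole
  space.\<close>

lemma rat_complement_nontrivial:
  fixes S :: "(real ^ 'n) set"
  assumes "finite S" "S \<subseteq> rat_vecs" "pairwise orthogonal S" "card S < CARD('n)"
  shows "\<exists>y \<in> rat_complement S. y \<noteq> 0"
proof (rule ccontr)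
  assume *: "\<not> (\<exists>y \<in> rat_complement S. y \<noteq> 0)"
  have "axis i 1 \<in> span S" for i :: 'n
  proof -
    let ?e = "axis i 1 :: real ^ 'n"
    let ?p = "\<Sum>b\<in>S. (b \<bullet> ?e / (b \<bullet> b)) *\<^sub>R b"
    have "?p \<in> rat_vecs"
      using assms(2) by (auto intro!: rat_vecs_sum rat_vecs_scale Rats_divide rat_vecs_inner rat_vecs_axis)
    then have "?e - ?p \<in> rat_complement S"
      using Gram_Schmidt_step[OF assms(3) span_base, of _ ?e]
      by (auto simp: rat_complement_def orthogonal_def inner_commute intro!: rat_vecs_diff rat_vecs_axis)
    then have "?e = ?p" using * by auto
    moreover have "?p \<in> span S" by (intro span_sum span_scale span_base)
    ultimately show ?thesis by simp
  qed
  then have "Basis \<subseteq> span S" by (auto simp: Basis_vec_def)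
  then have "(UNIV :: (real ^ 'n) set) \<subseteq> span S" by (metis span_Basis span_minimal subspace_span)
  then have "dim (UNIV :: (real ^ 'n) set) \<le> card S" using assms(1) by (rule dim_le_card)
  then show False using assms(4) by simp
qed

text \<open>For the matrix \<open>M\<close> with rows \<open>S\<close>, the product
  \<open>M ** transpose M\<close> is diagonal, and \<open>det M\<close> is rational.\<close>

lemma prod_norms_orthogonal_basis_square:
  fixes S :: "(real ^ 'n) set"
  assumes "S \<subseteq> rat_vecs" "pairwise orthogonal S" "finite S" "card S = CARD('n)"
  shows "\<exists>D\<in>\<rat>. (\<Prod>v\<in>S. v \<bullet> v) = D\<^sup>2"
proof -
  obtain f where f: "bij_betw f (UNIV :: 'n set) S"
    using assms(3,4) by (metis finite_class.finite_UNIV finite_same_card_bij)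
  define M where "M = (\<chi> i. f i)"
  have M: "M $ i = f i" for i by (simp add: M_def)
  have "(M ** transpose M) $ i $ j = f i \<bullet> f j" for i j
    by (simp add: matrix_matrix_mult_def transpose_def inner_vec_def M)
  moreover have "f i \<bullet> f j = 0" if "i \<noteq> j" for i j
    using assms(2) f that unfolding pairwise_def bij_betw_def orthogonal_def inj_on_def by auto
  ultimately have "det (M ** transpose M) = (\<Prod>i\<in>UNIV. f i \<bullet> f i)"
    by (subst det_diagonal) auto
  also have "\<dots> = (\<Prod>v\<in>S. v \<bullet> v)" using f by (rule prod.reindex_bij_betw)
  finally have "(\<Prod>v\<in>S. v \<bullet> v) = (det M)\<^sup>2" by (simp add: det_mul power2_eq_square)
  moreover have "M $ i $ j \<in> \<rat>" for i j
    using assms(1) f unfolding M bij_betw_def rat_vecs_def by auto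
  then have "det M \<in> \<rat>" unfolding det_def by (intro Rats_sum Rats_mult Rats_prod) auto
  ultimately show ?thesis by blast
qed

text \<open>Division by zero gives zero, so \<open>reflect 0\<close> is the identity; this is the
  right map when the two vectors to be exchanged coincide.\<close>

definition reflect :: "'a::real_inner \<Rightarrow> 'a \<Rightarrow> 'a" where
  "reflect d u = u - (2 * (u \<bullet> d) / (d \<bullet> d)) *\<^sub>R d"

lemma reflect_inner: "reflect d u \<bullet> reflect d v = u \<bullet> v"
  by (cases "d = 0") (simp_all add: reflect_def algebra_simps inner_commute)

lemma reflect_orthogonal: "u \<bullet> d = 0 \<Longrightarrow> reflect d u = u"
  by (simp add: reflect_def)

lemma reflect_diff:
  assumes "u \<bullet> u = v \<bullet> v"
  shows "reflect (u - v) u = v"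
proof (cases "u = v")
  case False
  have "2 * (u \<bullet> (u - v)) = (u - v) \<bullet> (u - v)"
    using assms by (simp add: algebra_simps inner_commute)
  then show ?thesis using False by (simp add: reflect_def)
qed (simp add: reflect_def)

lemma reflect_rat_complement:
  "d \<in> rat_complement S \<Longrightarrow> u \<in> rat_complement S \<Longrightarrow> reflect d u \<in> rat_complement S"
  unfolding reflect_def
  by (intro rat_complement_diff rat_complement_scale Rats_divide Rats_mult rat_complement_inner) auto

text \<open>Induction on the number \<open>k\<close> of planes still to be split off.
  \<open>S\<close> is an orthogonal basis of everything outside the remaining space, so the product
  of its norms is the determinant of that space up to squares. For \<open>k = 0\<close> it is a
  basis of the whole space, and \<open>X = 1\<close>, \<open>Y = 0\<close> will do.\<close>

lemma similarity_norm_equation: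
  fixes \<sigma> :: "real ^ 'n \<Rightarrow> real ^ 'n" and c :: real
  assumes "c \<in> \<rat>" "\<And>q. q \<in> \<rat> \<Longrightarrow> q\<^sup>2 \<noteq> c"
    and "finite S" "S \<subseteq> rat_vecs" "pairwise orthogonal S" "0 \<notin> S" "card S + 2 * k = CARD('n)"
    and "\<sigma> ` rat_complement S \<subseteq> rat_complement S"
    and "\<And>u v. u \<in> rat_complement S \<Longrightarrow> v \<in> rat_complement S \<Longrightarrow> \<sigma> u \<bullet> \<sigma> v = c * (u \<bullet> v)"
  shows "\<exists>X\<in>\<rat>. \<exists>Y\<in>\<rat>. \<exists>D\<in>\<rat>. D \<noteq> 0 \<and> (-1) ^ k * (\<Prod>v\<in>S. v \<bullet> v) * (X\<^sup>2 - c * Y\<^sup>2) = D\<^sup>2"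
  using assms(3-)
proof (induction k arbitrary: S \<sigma>)
  case 0
  then obtain D where D: "D \<in> \<rat>" "(\<Prod>v\<in>S. v \<bullet> v) = D\<^sup>2"
    using prod_norms_orthogonal_basis_square[of S] by auto
  moreover have "(\<Prod>v\<in>S. v \<bullet> v) \<noteq> 0" using 0 by auto
  ultimately show ?case by (intro bexI[of _ 1] bexI[of _ 0] bexI[of _ D]) auto
next
  case (Suc k)
  let ?W = "rat_complement S"
  obtain y where y: "y \<in> ?W" "y \<noteq> 0"
    using rat_complement_nontrivial[of S] Suc.prems by auto
  define x where "x = \<sigma> y"
  define b where "b = y \<bullet> y"
  define t where "t = x \<bullet> y"
  define z where "z = x - (t / b) *\<^sub>R y"
  \<comment> \<open>Reflection in \<open>d\<close> carries \<open>\<sigma> x\<close> to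
    \<open>c *\<^sub>R y\<close> and fixes \<open>x\<close>; \<open>d\<close> may be zero.\<close>
  define d where "d = \<sigma> x - c *\<^sub>R y"
  have x: "x \<in> ?W" using y Suc.prems(6) by (auto simp: x_def)
  have \<sigma>x: "\<sigma> x \<in> ?W" using x Suc.prems(6) by auto
  have d: "d \<in> ?W" unfolding d_def using \<sigma>x y assms(1) by (intro rat_complement_diff rat_complement_scale)
  have rat: "b \<in> \<rat>" "t \<in> \<rat>" unfolding b_def t_def using x y by (auto intro: rat_complement_inner)
  have z: "z \<in> ?W" unfolding z_def using x y rat by (intro rat_complement_diff rat_complement_scale Rats_divide)
  have b0: "b \<noteq> 0" using y by (simp add: b_def)
  have xx: "x \<bullet> x = c * b" using Suc.prems(7)[OF y(1) y(1)] by (simp add: x_def b_def)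
  have xsx: "x \<bullet> \<sigma> x = c * t" using Suc.prems(7)[OF y(1) x] by (simp add: x_def t_def inner_commute)
  have sxsx: "\<sigma> x \<bullet> \<sigma> x = c * (c * b)" using Suc.prems(7)[OF x x] xx by simp
  have yz: "y \<bullet> z = 0" using b0 by (simp add: z_def inner_diff_right t_def b_def inner_commute)
  have zz: "b * (z \<bullet> z) = c * b\<^sup>2 - t\<^sup>2"
  proof -
    have "z \<bullet> z = x \<bullet> x - 2 * (t / b) * t + (t / b)\<^sup>2 * b"
      by (simp add: z_def inner_diff_left inner_diff_right t_def b_def inner_commute power2_eq_square algebra_simps)
    then show ?thesis using b0 xx by (simp add: field_simps power2_eq_square)
  qed
  \<comment> \<open>If \<open>x\<close> were a rational multiple of \<open>y\<close>, comparing
    norms would make \<open>c\<close> the square of the factor.\<close>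
  have z0: "z \<noteq> 0"
  proof
    assume "z = 0"
    then have "(t / b)\<^sup>2 = c" using zz b0 by (simp add: field_simps power2_eq_square)
    then show False using assms(2)[of "t / b"] rat by auto
  qed
  define \<tau> where "\<tau> w = reflect d (\<sigma> w)" for w
  have \<tau>y: "\<tau> y = x"
    unfolding \<tau>_def x_def[symmetric]
    by (rule reflect_orthogonal) (simp add: d_def inner_diff_right xsx t_def[symmetric])
  have \<tau>x: "\<tau> x = c *\<^sub>R y"
    unfolding \<tau>_def d_def by (rule reflect_diff) (simp add: sxsx b_def)
  let ?S = "insert y (insert z S)"
  have notin: "y \<notin> insert z S" "z \<notin> S"
  proof -
    have "y \<notin> S" "z \<notin> S" using y z z0 by (auto simp: rat_complement_def)
    moreover have "y \<noteq> z" using yz y by auto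
    ultimately show "y \<notin> insert z S" "z \<notin> S" by auto
  qed
  \<comment> \<open>As \<open>z\<close> differs from \<open>x\<close> by a multiple of
    \<open>y\<close>, the new complement can be described by \<open>x\<close> and \<open>y\<close>,
    which \<tau> exchanges up to a factor. This makes its invariance visible.\<close>
  have W': "w \<in> rat_complement ?S \<longleftrightarrow> w \<in> ?W \<and> w \<bullet> y = 0 \<and> w \<bullet> x = 0" for w
  proof -
    have "w \<bullet> z = w \<bullet> x" if "w \<bullet> y = 0" using that by (simp add: z_def inner_diff_right)
    then show ?thesis by (auto simp: rat_complement_def)
  qed
  have c0: "c \<noteq> 0" using assms(2)[of 0] by auto
  have \<tau>inner: "\<tau> u \<bullet> \<tau> v = c * (u \<bullet> v)" if "u \<in> ?W" "v \<in> ?W" for u v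
    using Suc.prems(7)[OF that] by (simp add: \<tau>_def reflect_inner)
  have "\<exists>X\<in>\<rat>. \<exists>Y\<in>\<rat>. \<exists>D\<in>\<rat>. D \<noteq> 0 \<and> (-1) ^ k * (\<Prod>v\<in>?S. v \<bullet> v) * (X\<^sup>2 - c * Y\<^sup>2) = D\<^sup>2"
  proof (rule Suc.IH[of ?S \<tau>])
    show "finite ?S" using Suc.prems by simp
    show "?S \<subseteq> rat_vecs" using Suc.prems y z by (auto simp: rat_complement_def)
    show "pairwise orthogonal ?S"
      using Suc.prems(3) yz y z 
      by (auto simp: pairwise_def orthogonal_def rat_complement_def inner_commute)
    show "0 \<notin> ?S" using Suc.prems y z0 by auto
    show "card ?S + 2 * k = CARD('n)" using Suc.prems notin by simp
    show "\<tau> ` rat_complement ?S \<subseteq> rat_complement ?S"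
    proof (clarsimp simp only: W' image_subset_iff)
      fix w assume w: "w \<in> ?W" "w \<bullet> y = 0" "w \<bullet> x = 0"
      have "\<tau> w \<in> ?W" unfolding \<tau>_def using w d Suc.prems(6) by (intro reflect_rat_complement) auto
      moreover have "\<tau> w \<bullet> x = 0" using \<tau>inner[OF w(1) y(1)] w \<tau>y by simp
      moreover have "\<tau> w \<bullet> y = 0" using \<tau>inner[OF w(1) x] w \<tau>x c0 by simp
      ultimately show "\<tau> w \<in> ?W \<and> \<tau> w \<bullet> y = 0 \<and> \<tau> w \<bullet> x = 0" by blast
    qed
    show "\<tau> u \<bullet> \<tau> v = c * (u \<bullet> v)" if "u \<in> rat_complement ?S" "v \<in> rat_complement ?S" for u v
      using that \<tau>inner by (simp add: W')
  qed
  then obtain X Y D where XYD: "X \<in> \<rat>" "Y \<in> \<rat>" "D \<in> \<rat>" "D \<noteq> 0"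
    "(-1) ^ k * (\<Prod>v\<in>?S. v \<bullet> v) * (X\<^sup>2 - c * Y\<^sup>2) = D\<^sup>2" by blast
  have "(\<Prod>v\<in>?S. v \<bullet> v) = (c * b\<^sup>2 - t\<^sup>2) * (\<Prod>v\<in>S. v \<bullet> v)"
    using notin Suc.prems(1) zz by (simp add: b_def)
  then have "(-1) ^ k * (\<Prod>v\<in>S. v \<bullet> v) * ((c * b\<^sup>2 - t\<^sup>2) * (X\<^sup>2 - c * Y\<^sup>2)) = D\<^sup>2"
    using XYD(5) by (simp add: mult_ac)
  \<comment> \<open>The new coefficients are those of
    \<open>(t + b * sqrt c) * (X + Y * sqrt c)\<close>; the minus sign is absorbed by
    \<open>(-1) ^ Suc k\<close>.\<close>
  moreover have "(c * b\<^sup>2 - t\<^sup>2) * (X\<^sup>2 - c * Y\<^sup>2) = - ((t * X + c * b * Y)\<^sup>2 - c * (t * Y + b * X)\<^sup>2)"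
    by (simp add: algebra_simps power2_eq_square)
  ultimately have "(-1) ^ Suc k * (\<Prod>v\<in>S. v \<bullet> v) * ((t * X + c * b * Y)\<^sup>2 - c * (t * Y + b * X)\<^sup>2) = D\<^sup>2"
    by (simp only: power_Suc mult_minus_left mult_minus_right mult_1_left)
  moreover have "t * X + c * b * Y \<in> \<rat>" "t * Y + b * X \<in> \<rat>"
    using XYD rat assms(1) by (auto intro!: Rats_add Rats_mult)
  ultimately show ?case using XYD(3,4) by blast
qed

lemma Rats_common_denominator:
  fixes X Y D :: real
  assumes "X \<in> \<rat>" "Y \<in> \<rat>" "D \<in> \<rat>"
  obtains m x y d :: int where "m > 0" "m * X = x" "m * Y = y" "m * D = d"
proof -
  obtain x1 x2 where X: "x2 > 0" "X = of_int x1 / of_int x2" using assms(1) by (elim Rats_cases')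
  obtain y1 y2 where Y: "y2 > 0" "Y = of_int y1 / of_int y2" using assms(2) by (elim Rats_cases')
  obtain d1 d2 where D: "d2 > 0" "D = of_int d1 / of_int d2" using assms(3) by (elim Rats_cases')
  show thesis
    using X Y D by (intro that[of "x2 * y2 * d2" "x1 * y2 * d2" "y1 * x2 * d2" "d1 * x2 * y2"]) auto
qed

lemma nat_square_if_rat_square:
  fixes q :: real
  assumes "q \<in> \<rat>" "q\<^sup>2 = real c"
  shows "\<exists>m. c = m\<^sup>2"
proof -
  obtain m n where mn: "n \<noteq> 0" "\<bar>q\<bar> = real m / real n" "coprime m n"
    using Rats_abs_nat_div_natE[OF assms(1)] by metis
  then have "(real m / real n)\<^sup>2 = real c" using assms(2) by (metis power2_abs)
  then have "real (m\<^sup>2) = real (c * n\<^sup>2)" using mn(1) by (simp add: field_simps)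
  then have eq: "m\<^sup>2 = c * n\<^sup>2" by (simp only: of_nat_eq_iff)
  then have "n\<^sup>2 dvd m\<^sup>2" by simp
  then have "n dvd m" by simp
  then have "n = 1" using mn(3) by (metis coprime_absorb_right nat_dvd_1_iff_1)
  then show ?thesis using eq by auto
qed

text \<open>Passage from the lattice to its rational space, where \<open>dense\<close> supplies the
  denominators, and back to integers by clearing denominators. Square \<open>c\<close> are set apart
  since the norm equation was derived for nonsquare norms.\<close>

lemma multiplier_norm_equation:
  fixes \<Lambda> :: "(real ^ 'n) set"
  assumes "has_multiplier \<Lambda> (real c)"
    and "finite S" "S \<subseteq> rat_vecs" "pairwise orthogonal S" "0 \<notin> S" "card S + 2 * k = CARD('n)"
    and "(\<Prod>v\<in>S. v \<bullet> v) = of_int N"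
    and \<Lambda>: "\<Lambda> \<subseteq> rat_complement S"
    and dense: "\<And>w. w \<in> rat_complement S \<Longrightarrow> \<exists>m::nat. m > 0 \<and> real m *\<^sub>R w \<in> \<Lambda>"
  shows "(\<exists>m. c = m\<^sup>2) \<or>
    (\<exists>x y d :: int. d \<noteq> 0 \<and> (-1) ^ k * N * (x\<^sup>2 - int c * y\<^sup>2) = d\<^sup>2)"
proof (cases "\<exists>m. c = m\<^sup>2")
  case False
  obtain \<sigma> where \<sigma>: "similarity_on (span \<Lambda>) (real c) \<sigma>" "\<sigma> ` \<Lambda> \<subseteq> \<Lambda>"
    using assms(1) by (auto simp: has_multiplier_def multiplier_def)
  \<comment> \<open>A rational vector is a lattice vector divided by some \<open>m\<close>, and
    \<sigma> commutes with this division.\<close>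
  have W: "w \<in> span \<Lambda> \<and> \<sigma> w \<in> rat_complement S" if w: "w \<in> rat_complement S" for w
  proof -
    obtain m :: nat where m: "m > 0" "real m *\<^sub>R w \<in> \<Lambda>" using dense[OF w] by blast
    have eq: "w = (1 / real m) *\<^sub>R (real m *\<^sub>R w)" using m by simp
    have sp: "real m *\<^sub>R w \<in> span \<Lambda>" using m by (simp add: span_base)
    then have "w \<in> span \<Lambda>" by (subst eq) (rule span_scale)
    moreover have "\<sigma> w = (1 / real m) *\<^sub>R \<sigma> (real m *\<^sub>R w)"
      by (subst eq) (use \<sigma>(1) sp in \<open>simp only: similarity_on_def\<close>)
    moreover have "\<sigma> (real m *\<^sub>R w) \<in> rat_complement S" using \<sigma>(2) \<Lambda> m by auto
    ultimately show ?thesis by (auto intro: rat_complement_scale)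
  qed
  have "\<exists>X\<in>\<rat>. \<exists>Y\<in>\<rat>. \<exists>D\<in>\<rat>. D \<noteq> 0 \<and> (-1) ^ k * (\<Prod>v\<in>S. v \<bullet> v) * (X\<^sup>2 - real c * Y\<^sup>2) = D\<^sup>2"
  proof (rule similarity_norm_equation[where \<sigma> = \<sigma>])
    show "q\<^sup>2 \<noteq> real c" if "q \<in> \<rat>" for q using nat_square_if_rat_square[OF that] False by blast
    show "\<sigma> u \<bullet> \<sigma> v = real c * (u \<bullet> v)" if "u \<in> rat_complement S" "v \<in> rat_complement S" for u v
      using \<sigma>(1) W that by (auto simp: similarity_on_def)
  qed (use assms W in auto)
  then obtain X Y D where XYD: "X \<in> \<rat>" "Y \<in> \<rat>" "D \<in> \<rat>" "D \<noteq> 0"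
    "(-1) ^ k * (\<Prod>v\<in>S. v \<bullet> v) * (X\<^sup>2 - real c * Y\<^sup>2) = D\<^sup>2" by blast
  obtain m x y d :: int where m: "m > 0" "m * X = x" "m * Y = y" "m * D = d"
    using Rats_common_denominator[OF XYD(1-3)] .
  have "(-1) ^ k * real_of_int N * (real_of_int x ^ 2 - real c * real_of_int y ^ 2)
      = (real_of_int m)\<^sup>2 * ((-1) ^ k * (\<Prod>v\<in>S. v \<bullet> v) * (X\<^sup>2 - real c * Y\<^sup>2))"
    unfolding m(2,3)[symmetric] assms(7) by (simp add: algebra_simps power2_eq_square)
  also have "\<dots> = (real_of_int d)\<^sup>2"
    unfolding XYD(5) m(4)[symmetric] by (simp add: power_mult_distrib)
  finally have "real_of_int ((-1) ^ k * N * (x\<^sup>2 - int c * y\<^sup>2)) = real_of_int (d\<^sup>2)" by simp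
  then have "(-1) ^ k * N * (x\<^sup>2 - int c * y\<^sup>2) = d\<^sup>2" by (simp only: of_int_eq_iff)
  moreover have "d \<noteq> 0" using m(1,4) XYD(4) by auto
  ultimately show ?thesis by blast
qed simp

section \<open>Coordinates indexed by the types 5, 6 and 8\<close>

lemma exhaust_5:
  fixes x :: 5
  shows "x = 1 \<or> x = 2 \<or> x = 3 \<or> x = 4 \<or> x = 5"
proof (induct x)
  case (of_int z)
  then have "z = 0 \<or> z = 1 \<or> z = 2 \<or> z = 3 \<or> z = 4" by auto
  then show ?case by auto
qed

lemma UNIV_5: "UNIV = {1, 2, 3, 4, 5::5}" using exhaust_5 by auto

lemma sum_5: "sum f (UNIV::5 set) = f 1 + f 2 + f 3 + f 4 + f 5"
  unfolding UNIV_5 by (simp add: ac_simps)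

lemma exhaust_6:
  fixes x :: 6
  shows "x = 1 \<or> x = 2 \<or> x = 3 \<or> x = 4 \<or> x = 5 \<or> x = 6"
proof (induct x)
  case (of_int z)
  then have "z = 0 \<or> z = 1 \<or> z = 2 \<or> z = 3 \<or> z = 4 \<or> z = 5" by auto
  then show ?case by auto
qed

lemma UNIV_6: "UNIV = {1, 2, 3, 4, 5, 6::6}" using exhaust_6 by auto

lemma sum_6: "sum f (UNIV::6 set) = f 1 + f 2 + f 3 + f 4 + f 5 + f 6"
  unfolding UNIV_6 by (simp add: ac_simps)

lemma forall_6: "(\<forall>i::6. P i) \<longleftrightarrow> P 1 \<and> P 2 \<and> P 3 \<and> P 4 \<and> P 5 \<and> P 6"
  by (metis exhaust_6)

lemma exhaust_8:
  fixes x :: 8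
  shows "x = 1 \<or> x = 2 \<or> x = 3 \<or> x = 4 \<or> x = 5 \<or> x = 6 \<or> x = 7 \<or> x = 8"
proof (induct x)
  case (of_int z)
  then have "z = 0 \<or> z = 1 \<or> z = 2 \<or> z = 3 \<or> z = 4 \<or> z = 5 \<or> z = 6 \<or> z = 7" by auto
  then show ?case by auto
qed

lemma UNIV_8: "UNIV = {1, 2, 3, 4, 5, 6, 7, 8::8}" using exhaust_8 by auto

lemma sum_8: "sum f (UNIV::8 set) = f 1 + f 2 + f 3 + f 4 + f 5 + f 6 + f 7 + f 8"
  unfolding UNIV_8 by (simp add: ac_simps)

lemma forall_8: "(\<forall>i::8. P i) \<longleftrightarrow> P 1 \<and> P 2 \<and> P 3 \<and> P 4 \<and> P 5 \<and> P 6 \<and> P 7 \<and> P 8"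
  by (metis exhaust_8)

section \<open>Norm equations of the individual lattices\<close>

lemma rat_vecs_denominator:
  fixes w :: "real ^ 'n"
  assumes "w \<in> rat_vecs"
  shows "\<exists>m::nat. m > 0 \<and> real m *\<^sub>R w \<in> integer_lattice"
proof -
  have "\<exists>b::int. b > 0 \<and> (\<exists>a::int. w $ i = of_int a / of_int b)" for i
    using assms by (auto simp: rat_vecs_def elim!: Rats_cases' dest!: spec[of _ i])
  then obtain b a :: "'n \<Rightarrow> int" where ab: "\<And>i. b i > 0" "\<And>i. w $ i = of_int (a i) / of_int (b i)"
    by metis
  define m where "m = (\<Prod>i\<in>UNIV. b i)"
  have "m > 0" unfolding m_def using ab by (intro prod_pos) auto
  moreover have "of_int m * w $ i \<in> \<int>" for i
  proof -
    have "m = b i * prod b (UNIV - {i})" unfolding m_def by (simp add: prod.remove)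
    then have "of_int m * w $ i = of_int (prod b (UNIV - {i}) * a i)"
      using ab[of i] by simp
    then show ?thesis by (metis Ints_of_int)
  qed
  ultimately show ?thesis
    by (intro exI[of _ "nat m"]) (auto simp: integer_lattice_def)
qed

lemma integer_lattice_subset_rat_vecs: "integer_lattice \<subseteq> rat_vecs"
  using Ints_subset_Rats by (auto simp: integer_lattice_def rat_vecs_def)

lemma rat_complement_empty: "rat_complement {} = rat_vecs"
  by (simp add: rat_complement_def)

lemma inner_ones: "x \<bullet> (\<chi> i. 1) = (\<Sum>i\<in>UNIV. x $ i)" for x :: "real ^ 'n"
  by (simp add: inner_vec_def)

lemma integer_lattice_norm_equation:
  assumes "has_multiplier (integer_lattice :: (real ^ 'n) set) (real c)" "2 * k = CARD('n)"
  shows "(\<exists>m. c = m\<^sup>2) \<or>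
    (\<exists>x y d :: int. d \<noteq> 0 \<and> (-1) ^ k * (x\<^sup>2 - int c * y\<^sup>2) = d\<^sup>2)"
  using multiplier_norm_equation[OF assms(1), of "{}" k 1] assms(2)
  by (simp add: rat_complement_empty integer_lattice_subset_rat_vecs rat_vecs_denominator)

lemma A_lattice_norm_equation:
  assumes "has_multiplier (A_lattice :: (real ^ 'n) set) (real c)" "1 + 2 * k = CARD('n)"
  shows "(\<exists>m. c = m\<^sup>2) \<or>
    (\<exists>x y d :: int. d \<noteq> 0 \<and> (-1) ^ k * int CARD('n) * (x\<^sup>2 - int c * y\<^sup>2) = d\<^sup>2)"
proof (rule multiplier_norm_equation[OF assms(1), of "{\<chi> i. 1}"])
  show "A_lattice \<subseteq> rat_complement {\<chi> i. 1}"
    using integer_lattice_subset_rat_vecs by (auto simp: A_lattice_def rat_complement_def inner_ones)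
  show "\<exists>m>0. real m *\<^sub>R w \<in> A_lattice" if w: "w \<in> rat_complement {\<chi> i. 1}" for w :: "real ^ 'n"
  proof -
    have "w \<in> rat_vecs" "(\<Sum>i\<in>UNIV. w $ i) = 0" using w by (auto simp: rat_complement_def inner_ones)
    then show ?thesis using rat_vecs_denominator[of w]
      by (auto simp: A_lattice_def simp flip: sum_distrib_left)
  qed
qed (use assms(2) in \<open>auto simp: rat_vecs_def vec_eq_iff pairwise_def inner_ones\<close>)

lemma E6_lattice_norm_equation:
  assumes "has_multiplier E6_lattice (real c)"
  shows "(\<exists>m. c = m\<^sup>2) \<or>
    (\<exists>x y d :: int. d \<noteq> 0 \<and> (-1) ^ 3 * 12 * (x\<^sup>2 - int c * y\<^sup>2) = d\<^sup>2)"
proof (rule multiplier_norm_equation[OF assms])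
  \<comment> \<open>An orthogonal basis of the complement of the space of \<open>E6_lattice\<close>,
    with norms 2 and 6. Their product 12 agrees up to a square with the determinant 3 of the
    lattice.\<close>
  let ?u = "axis 6 1 - axis 7 1 :: real ^ 8" and ?v = "axis 6 1 + axis 7 1 - 2 *\<^sub>R axis 8 1 :: real ^ 8"
  have ne: "?u \<noteq> ?v"
  proof
    assume "?u = ?v"
    then have "?u $ 8 = ?v $ 8" by (rule arg_cong)
    moreover have "?u $ 8 = 0" "?v $ 8 = -2" by (simp_all add: axis_def)
    ultimately show False by simp
  qed
  have u: "x \<bullet> ?u = x $ 6 - x $ 7" and v: "x \<bullet> ?v = x $ 6 + x $ 7 - 2 * x $ 8" for x
    by (simp_all add: inner_diff_right inner_add_right inner_axis)
  have mem: "x \<in> rat_complement {?u, ?v} \<longleftrightarrow> x \<in> rat_vecs \<and> x $ 6 = x $ 7 \<and> x $ 7 = x $ 8" for x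
    unfolding rat_complement_def by (auto simp: u v)
  show "finite {?u, ?v}" by simp
  show "{?u, ?v} \<subseteq> rat_vecs" by (auto intro!: rat_vecs_add rat_vecs_diff rat_vecs_scale rat_vecs_axis)
  show "pairwise orthogonal {?u, ?v}"
    proof -
    have "?u \<bullet> ?v = 0" unfolding v by (simp add: axis_def)
    then show ?thesis by (auto simp: pairwise_insert orthogonal_def inner_commute)
  qed
  show "0 \<notin> {?u, ?v}"
  proof -
    have "?u $ 6 \<noteq> 0" "?v $ 6 \<noteq> 0" by (simp_all add: axis_def)
    then show ?thesis by (metis insert_iff singletonD zero_index)
  qed
  show "card {?u, ?v} + 2 * 3 = CARD(8)" using ne by simp
  show "(\<Prod>x\<in>{?u, ?v}. x \<bullet> x) = of_int 12" using ne by (simp add: u v) (simp add: axis_def)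
  show "E6_lattice \<subseteq> rat_complement {?u, ?v}"
  proof
    fix x assume x: "x \<in> E6_lattice"
    have "x $ i \<in> \<rat>" for i
    proof -
      have "x $ i \<in> \<int> \<or> x $ i - 1/2 \<in> \<int>" using x by (auto simp: E6_lattice_def E8_lattice_def)
      then have "x $ i \<in> \<rat> \<or> x $ i - 1/2 \<in> \<rat>" using Ints_subset_Rats by blast
      moreover have "x $ i = (x $ i - 1/2) + 1/2" by simp
      ultimately show ?thesis by (metis Rats_add Rats_divide Rats_1 Rats_number_of)
    qed
    then show "x \<in> rat_complement {?u, ?v}" using x unfolding mem by (simp add: E6_lattice_def rat_vecs_def)
  qed
  show "\<exists>m>0. real m *\<^sub>R w \<in> E6_lattice" if w: "w \<in> rat_complement {?u, ?v}" for w
  proof -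
    obtain m where m: "m > 0" "real m *\<^sub>R w \<in> integer_lattice"
      using rat_vecs_denominator[of w] w by (auto simp: mem)
    \<comment> \<open>The extra factor 2 makes half the coordinate sum an integer.\<close>
    have "(\<Sum>i\<in>UNIV. real (2 * m) * w $ i) / 2 = (\<Sum>i\<in>UNIV. real m * w $ i)"
      by (simp add: sum_divide_distrib)
    also have "\<dots> \<in> \<int>" using m by (auto simp: integer_lattice_def intro!: Ints_sum)
    finally have "(\<Sum>i\<in>UNIV. real (2 * m) * w $ i) / 2 \<in> \<int>" .
    moreover have "real (2 * m) * w $ i \<in> \<int>" for i
      using m by (auto simp: integer_lattice_def mult.assoc intro: Ints_mult)
    ultimately have "real (2 * m) *\<^sub>R w \<in> E6_lattice"
      using w by (simp add: mem E6_lattice_def E8_lattice_def)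
    then show ?thesis using m(1) by (intro exI[of _ "2 * m"]) simp
  qed
qed

lemma binform_of_square: "int (m\<^sup>2) * 1\<^sup>2 = binform b e (int m) 0"
  by (simp add: binform_def)

text \<open>For odd \<open>k\<close> the sign in the norm equation turns it into
  \<open>c * y\<^sup>2 = x\<^sup>2 + d\<^sup>2\<close>.\<close>

lemma integer_lattice_binform:
  assumes "has_multiplier (integer_lattice :: (real ^ 'n) set) (real c)" "2 * k = CARD('n)" "odd k"
  shows "\<exists>y r s. y \<noteq> 0 \<and> int c * y\<^sup>2 = binform 0 1 r s"
  using integer_lattice_norm_equation[OF assms(1,2)]
proof (elim disjE exE conjE)
  fix x y d :: int
  assume d: "d \<noteq> 0" "(-1) ^ k * (x\<^sup>2 - int c * y\<^sup>2) = d\<^sup>2"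
  then have eq: "int c * y\<^sup>2 = binform 0 1 x d" using assms(3) by (simp add: binform_def)
  then have "y \<noteq> 0" using binform_pos(1)[of x d] d(1) by auto
  then show ?thesis using eq by blast
qed (metis binform_of_square one_neq_zero)

lemma A2_lattice_binform:
  assumes "has_multiplier A2_lattice (real c)"
  shows "\<exists>y r s. y \<noteq> 0 \<and> int c * y\<^sup>2 = binform (-1) 1 r s"
proof -
  have "1 + 2 * 1 = CARD(3)" by simp
  from A_lattice_norm_equation[OF assms this] show ?thesis
  proof (elim disjE exE conjE)
    fix x y d :: int
    assume d: "d \<noteq> 0" "(-1) ^ 1 * int CARD(3) * (x\<^sup>2 - int c * y\<^sup>2) = d\<^sup>2"
    \<comment> \<open>These are the coordinates of \<open>3 * x + d * sqrt (-3)\<close>, where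
      \<open>sqrt (-3) = 1 + 2 * \<omega>\<close>.\<close>
    have "int c * (3 * y)\<^sup>2 = binform (-1) 1 (3 * x + d) (2 * d)"
      using d(2) by (simp add: binform_def algebra_simps power2_eq_square)
    moreover have "binform (-1) 1 (3 * x + d) (2 * d) > 0" using d(1) by (intro binform_pos) simp
    then have "3 * y \<noteq> 0" using calculation by auto
    ultimately show ?thesis by blast
  qed (metis binform_of_square one_neq_zero)
qed

lemma E6_lattice_binform:
  assumes "has_multiplier E6_lattice (real c)"
  shows "\<exists>y r s. y \<noteq> 0 \<and> int c * y\<^sup>2 = binform (-1) 1 r s"
  using E6_lattice_norm_equation[OF assms]
proof (elim disjE exE conjE)
  fix x y d :: int
  assume d: "d \<noteq> 0" "(-1) ^ 3 * 12 * (x\<^sup>2 - int c * y\<^sup>2) = d\<^sup>2"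
  \<comment> \<open>The coordinates of \<open>12 * x + 2 * d * sqrt (-3)\<close>.\<close>
  have "int c * (12 * y)\<^sup>2 = binform (-1) 1 (12 * x + 2 * d) (4 * d)"
    using d(2) by (simp add: binform_def algebra_simps power2_eq_square)
  moreover have "binform (-1) 1 (12 * x + 2 * d) (4 * d) > 0" using d(1) by (intro binform_pos) simp
  then have "12 * y \<noteq> 0" using calculation by auto
  ultimately show ?thesis by blast
qed (metis binform_of_square one_neq_zero)

lemma A4_lattice_binform:
  assumes "has_multiplier A4_lattice (real c)"
  shows "\<exists>y r s. y \<noteq> 0 \<and> int c * y\<^sup>2 = binform 1 (-1) r s"
proof -
  have "1 + 2 * 2 = CARD(5)" by simp
  from A_lattice_norm_equation[OF assms this] show ?thesis
  proof (elim disjE exE conjE)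
    fix x y d :: int
    assume d: "d \<noteq> 0" "(-1) ^ 2 * int CARD(5) * (x\<^sup>2 - int c * y\<^sup>2) = d\<^sup>2"
    \<comment> \<open>The coordinates of \<open>5 * x + d * sqrt 5\<close>, where
      \<open>sqrt 5 = 2 * \<theta> - 1\<close> for the golden ratio \<theta>.\<close>
    have "int c * (5 * y)\<^sup>2 = binform 1 (-1) (5 * x - d) (2 * d)"
      using d(2) by (simp add: binform_def algebra_simps power2_eq_square)
    moreover have "binform 1 (-1) (5 * x - d) (2 * d) \<noteq> 0" using d(1) by (intro binform_golden_nonzero) simp
    then have "5 * y \<noteq> 0" using calculation by auto
    ultimately show ?thesis by blast
  qed (metis binform_of_square one_neq_zero)
qed

section \<open>Reduction of even lattices of determinant 5\<close>

definition gram2 :: "'a::real_inner \<Rightarrow> 'a \<Rightarrow> real" where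
  "gram2 a b = (a \<bullet> a) * (b \<bullet> b) - (a \<bullet> b)\<^sup>2"

definition gram3 :: "'a::real_inner \<Rightarrow> 'a \<Rightarrow> 'a \<Rightarrow> real" where
  "gram3 a b c = (a \<bullet> a) * (b \<bullet> b) * (c \<bullet> c) + 2 * (a \<bullet> b) * (b \<bullet> c) * (a \<bullet> c)
     - (a \<bullet> a) * (b \<bullet> c)\<^sup>2 - (b \<bullet> b) * (a \<bullet> c)\<^sup>2 - (c \<bullet> c) * (a \<bullet> b)\<^sup>2"

text \<open>The Leibniz expansion of the determinant of the symmetric matrix of inner
  products.\<close>

definition gram4 :: "'a::real_inner \<Rightarrow> 'a \<Rightarrow> 'a \<Rightarrow> 'a \<Rightarrow> real" where
  "gram4 a b c d =
     (a \<bullet> a) * (b \<bullet> b) * (c \<bullet> c) * (d \<bullet> d)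
     - (a \<bullet> a) * (b \<bullet> b) * (c \<bullet> d)\<^sup>2 - (a \<bullet> a) * (c \<bullet> c) * (b \<bullet> d)\<^sup>2 - (a \<bullet> a) * (d \<bullet> d) * (b \<bullet> c)\<^sup>2
     - (b \<bullet> b) * (c \<bullet> c) * (a \<bullet> d)\<^sup>2 - (b \<bullet> b) * (d \<bullet> d) * (a \<bullet> c)\<^sup>2 - (c \<bullet> c) * (d \<bullet> d) * (a \<bullet> b)\<^sup>2
     + 2 * (a \<bullet> a) * (b \<bullet> c) * (b \<bullet> d) * (c \<bullet> d) + 2 * (b \<bullet> b) * (a \<bullet> c) * (a \<bullet> d) * (c \<bullet> d)
     + 2 * (c \<bullet> c) * (a \<bullet> b) * (a \<bullet> d) * (b \<bullet> d) + 2 * (d \<bullet> d) * (a \<bullet> b) * (a \<bullet> c) * (b \<bullet> c)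
     + (a \<bullet> b)\<^sup>2 * (c \<bullet> d)\<^sup>2 + (a \<bullet> c)\<^sup>2 * (b \<bullet> d)\<^sup>2 + (a \<bullet> d)\<^sup>2 * (b \<bullet> c)\<^sup>2
     - 2 * (a \<bullet> b) * (a \<bullet> c) * (b \<bullet> d) * (c \<bullet> d) - 2 * (a \<bullet> b) * (a \<bullet> d) * (b \<bullet> c) * (c \<bullet> d)
     - 2 * (a \<bullet> c) * (a \<bullet> d) * (b \<bullet> c) * (b \<bullet> d)"

lemma gram2_commute: "gram2 a b = gram2 b a"
  by (simp add: gram2_def inner_commute)

lemma gram3_swap: "gram3 b a c = gram3 a b c" "gram3 a c b = gram3 a b c"
  by (simp_all add: gram3_def inner_commute algebra_simps)

lemma gram4_swap: "gram4 b a c d = gram4 a b c d" "gram4 a c b d = gram4 a b c d" "gram4 a b d c = gram4 a b c d"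
  by (simp_all add: gram4_def inner_commute algebra_simps)

lemma gram4_minus: "gram4 a b (- c) d = gram4 a b c d"
  by (simp add: gram4_def)

lemma gram4_add: "gram4 (a + t *\<^sub>R b) b c d = gram4 a b c d"
  by (simp add: gram4_def inner_add_left inner_add_right inner_commute algebra_simps power2_eq_square)

lemma gram4_add': "gram4 a b c (d + t *\<^sub>R a) = gram4 a b c d" "gram4 a b c (d + t *\<^sub>R b) = gram4 a b c d"
  "gram4 a b c (d + t *\<^sub>R c) = gram4 a b c d"
  "gram4 a b (c + t *\<^sub>R a) d = gram4 a b c d" "gram4 a b (c + t *\<^sub>R b) d = gram4 a b c d"
  "gram4 a (b + t *\<^sub>R a) c d = gram4 a b c d"
  by (metis gram4_add gram4_swap)+

text \<open>The coefficients are parameters so that several quadruples can share the same orthogonal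
  vectors: size reduction changes the quadruple and the coefficients only.\<close>

locale gram_schmidt4 =
  fixes b1 b2 b3 b4 f1 f2 f3 f4 :: "'a::real_inner" and m21 m31 m32 m41 m42 m43 :: real
  assumes orth: "f1 \<bullet> f2 = 0" "f1 \<bullet> f3 = 0" "f1 \<bullet> f4 = 0" "f2 \<bullet> f3 = 0" "f2 \<bullet> f4 = 0" "f3 \<bullet> f4 = 0"
    and b: "b1 = f1" "b2 = f2 + m21 *\<^sub>R f1" "b3 = f3 + m32 *\<^sub>R f2 + m31 *\<^sub>R f1"
      "b4 = f4 + m43 *\<^sub>R f3 + m42 *\<^sub>R f2 + m41 *\<^sub>R f1"
begin

lemma inner_b:
  "b1 \<bullet> b1 = f1 \<bullet> f1" "b2 \<bullet> b2 = f2 \<bullet> f2 + m21\<^sup>2 * (f1 \<bullet> f1)"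
  "b3 \<bullet> b3 = f3 \<bullet> f3 + m32\<^sup>2 * (f2 \<bullet> f2) + m31\<^sup>2 * (f1 \<bullet> f1)"
  "b4 \<bullet> b4 = f4 \<bullet> f4 + m43\<^sup>2 * (f3 \<bullet> f3) + m42\<^sup>2 * (f2 \<bullet> f2) + m41\<^sup>2 * (f1 \<bullet> f1)"
  "b1 \<bullet> b2 = m21 * (f1 \<bullet> f1)" "b1 \<bullet> b3 = m31 * (f1 \<bullet> f1)" "b1 \<bullet> b4 = m41 * (f1 \<bullet> f1)"
  "b2 \<bullet> b3 = m32 * (f2 \<bullet> f2) + m21 * m31 * (f1 \<bullet> f1)"
  "b2 \<bullet> b4 = m42 * (f2 \<bullet> f2) + m21 * m41 * (f1 \<bullet> f1)"
  "b3 \<bullet> b4 = m43 * (f3 \<bullet> f3) + m32 * m42 * (f2 \<bullet> f2) + m31 * m41 * (f1 \<bullet> f1)"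
  using orth by (simp_all add: b inner_add_left inner_add_right inner_commute power2_eq_square algebra_simps)

lemma gram2_b: "gram2 b1 b2 = (f1 \<bullet> f1) * (f2 \<bullet> f2)"
  and gram2_b_swap: "gram2 b1 b3 = (f1 \<bullet> f1) * (f3 \<bullet> f3 + m32\<^sup>2 * (f2 \<bullet> f2))"
  unfolding gram2_def inner_b by (simp_all add: power2_eq_square algebra_simps)

lemma gram3_b: "gram3 b1 b2 b3 = (f1 \<bullet> f1) * (f2 \<bullet> f2) * (f3 \<bullet> f3)"
  and gram3_b_swap: "gram3 b1 b2 b4 = (f1 \<bullet> f1) * (f2 \<bullet> f2) * (f4 \<bullet> f4 + m43\<^sup>2 * (f3 \<bullet> f3))"
  unfolding gram3_def inner_b by (simp_all add: power2_eq_square algebra_simps)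

lemma gram4_b: "gram4 b1 b2 b3 b4 = (f1 \<bullet> f1) * (f2 \<bullet> f2) * (f3 \<bullet> f3) * (f4 \<bullet> f4)"
proof -
  have "gram4 b1 b2 b3 b4 = gram4 f1 f2 f3 f4"
    unfolding b gram4_add' ..
  also have "\<dots> = (f1 \<bullet> f1) * (f2 \<bullet> f2) * (f3 \<bullet> f3) * (f4 \<bullet> f4)" by (simp add: gram4_def orth)
  finally show ?thesis .
qed

end

lemma gram_schmidt4_exists:
  "\<exists>f1 f2 f3 f4 m21 m31 m32 m41 m42 m43. gram_schmidt4 b1 b2 b3 b4 f1 f2 f3 f4 m21 m31 m32 m41 m42 m43"
proof -
  \<comment> \<open>Linearly dependent vectors are covered: for \<open>f = 0\<close> the inner
    product vanishes anyway.\<close>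
  have proj: "(x - (x \<bullet> f / (f \<bullet> f)) *\<^sub>R f) \<bullet> f = 0" for x f :: 'a
    by (cases "f = 0") (simp_all add: inner_diff_left)
  define f1 where "f1 = b1"
  define f2 where "f2 = b2 - (b2 \<bullet> f1 / (f1 \<bullet> f1)) *\<^sub>R f1"
  have 12: "f2 \<bullet> f1 = 0" unfolding f2_def by (rule proj)
  define c3 where "c3 = b3 - (b3 \<bullet> f1 / (f1 \<bullet> f1)) *\<^sub>R f1"
  have c3: "c3 \<bullet> f1 = 0" unfolding c3_def by (rule proj)
  define f3 where "f3 = c3 - (c3 \<bullet> f2 / (f2 \<bullet> f2)) *\<^sub>R f2"
  have 23: "f3 \<bullet> f2 = 0" unfolding f3_def by (rule proj)
  have 13: "f3 \<bullet> f1 = 0" using c3 12 by (simp add: f3_def inner_diff_left)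
  define c4 where "c4 = b4 - (b4 \<bullet> f1 / (f1 \<bullet> f1)) *\<^sub>R f1"
  have c4: "c4 \<bullet> f1 = 0" unfolding c4_def by (rule proj)
  define d4 where "d4 = c4 - (c4 \<bullet> f2 / (f2 \<bullet> f2)) *\<^sub>R f2"
  have d4: "d4 \<bullet> f2 = 0" unfolding d4_def by (rule proj)
  have d4': "d4 \<bullet> f1 = 0" using c4 12 by (simp add: d4_def inner_diff_left)
  define f4 where "f4 = d4 - (d4 \<bullet> f3 / (f3 \<bullet> f3)) *\<^sub>R f3"
  have 34: "f4 \<bullet> f3 = 0" unfolding f4_def by (rule proj)
  have 24: "f4 \<bullet> f2 = 0" using d4 23 by (simp add: f4_def inner_diff_left)
  have 14: "f4 \<bullet> f1 = 0" using d4' 13 by (simp add: f4_def inner_diff_left)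
  have "gram_schmidt4 b1 b2 b3 b4 f1 f2 f3 f4 (b2 \<bullet> f1 / (f1 \<bullet> f1)) (b3 \<bullet> f1 / (f1 \<bullet> f1))
     (c3 \<bullet> f2 / (f2 \<bullet> f2)) (b4 \<bullet> f1 / (f1 \<bullet> f1)) (c4 \<bullet> f2 / (f2 \<bullet> f2)) (d4 \<bullet> f3 / (f3 \<bullet> f3))"
  proof
    show "f1 \<bullet> f2 = 0" "f1 \<bullet> f3 = 0" "f1 \<bullet> f4 = 0" "f2 \<bullet> f3 = 0" "f2 \<bullet> f4 = 0" "f3 \<bullet> f4 = 0"
      using 12 13 14 23 24 34 by (simp_all only: inner_commute)
    show "b1 = f1" "b2 = f2 + (b2 \<bullet> f1 / (f1 \<bullet> f1)) *\<^sub>R f1" by (simp_all add: f1_def f2_def)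
    show "b3 = f3 + (c3 \<bullet> f2 / (f2 \<bullet> f2)) *\<^sub>R f2 + (b3 \<bullet> f1 / (f1 \<bullet> f1)) *\<^sub>R f1"
      by (simp add: f3_def c3_def)
    show "b4 = f4 + (d4 \<bullet> f3 / (f3 \<bullet> f3)) *\<^sub>R f3 + (c4 \<bullet> f2 / (f2 \<bullet> f2)) *\<^sub>R f2 + (b4 \<bullet> f1 / (f1 \<bullet> f1)) *\<^sub>R f1"
      by (simp add: f4_def d4_def c4_def)
  qed
  then show ?thesis by blast
qed

section \<open>LLL reduction inside even lattices\<close>

locale even_lattice =
  fixes M :: "'a::real_inner set"
  assumes add: "x \<in> M \<Longrightarrow> y \<in> M \<Longrightarrow> x + y \<in> M"
    and minus: "x \<in> M \<Longrightarrow> - x \<in> M"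
    and inner_int: "x \<in> M \<Longrightarrow> y \<in> M \<Longrightarrow> x \<bullet> y \<in> \<int>"
    and even: "x \<in> M \<Longrightarrow> \<exists>k::int. x \<bullet> x = 2 * k"
begin

lemma diff: "x \<in> M \<Longrightarrow> y \<in> M \<Longrightarrow> x - y \<in> M"
  using add minus by (metis diff_conv_add_uminus)

lemma add_int_scale: "x \<in> M \<Longrightarrow> y \<in> M \<Longrightarrow> x + of_int n *\<^sub>R y \<in> M"
proof (induction n rule: int_induct[where k = 0])
  case (step1 i)
  then show ?case using add[of "x + of_int i *\<^sub>R y" y] by (simp add: algebra_simps)
next
  case (step2 i)
  then show ?case using diff[of "x + of_int i *\<^sub>R y" y] by (simp add: algebra_simps)
qed simp

lemma size_reduce:
  assumes "gram_schmidt4 b1 b2 b3 b4 f1 f2 f3 f4 m21 m31 m32 m41 m42 m43" "{b1, b2, b3, b4} \<subseteq> M"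
  shows "\<exists>c2 c3 c4 m21 m31 m32 m41 m42 m43. {b1, c2, c3, c4} \<subseteq> M \<and>
    gram_schmidt4 b1 c2 c3 c4 f1 f2 f3 f4 m21 m31 m32 m41 m42 m43 \<and>
    \<bar>m21\<bar> \<le> 1/2 \<and> \<bar>m31\<bar> \<le> 1/2 \<and> \<bar>m32\<bar> \<le> 1/2 \<and> \<bar>m41\<bar> \<le> 1/2 \<and> \<bar>m42\<bar> \<le> 1/2 \<and> \<bar>m43\<bar> \<le> 1/2"
proof -
  have near: "\<exists>n::int. \<bar>x + of_int n\<bar> \<le> 1/2" for x :: real
    using of_int_round_abs_le[of x] by (intro exI[of _ "- round x"]) (simp add: abs_minus_commute)
  interpret gram_schmidt4 b1 b2 b3 b4 f1 f2 f3 f4 m21 m31 m32 m41 m42 m43 by (fact assms(1))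
  have M: "b1 \<in> M" "b2 \<in> M" "b3 \<in> M" "b4 \<in> M" using assms(2) by auto
  obtain n21 :: int where n21: "\<bar>m21 + of_int n21\<bar> \<le> 1/2" using near by blast
  define m21' c2 where "m21' = m21 + of_int n21" and "c2 = b2 + of_int n21 *\<^sub>R b1"
  have c2: "c2 \<in> M" "c2 = f2 + m21' *\<^sub>R f1"
    using M by (simp add: c2_def add_int_scale) (simp add: c2_def m21'_def b algebra_simps)
  \<comment> \<open>The coefficient at \<open>f2\<close> is rounded first, since adding multiples of
    \<open>c2\<close> also changes the coefficient at \<open>f1\<close>. The fourth vector is
    treated in the same order.\<close>
  obtain n32 :: int where n32: "\<bar>m32 + of_int n32\<bar> \<le> 1/2" using near by blast
  obtain n31 :: int where n31: "\<bar>(m31 + of_int n32 * m21') + of_int n31\<bar> \<le> 1/2" using near by blast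
  define m32' m31' c3 where "m32' = m32 + of_int n32" and "m31' = (m31 + of_int n32 * m21') + of_int n31"
    and "c3 = b3 + of_int n32 *\<^sub>R c2 + of_int n31 *\<^sub>R b1"
  have c3M: "c3 \<in> M" using M c2(1) by (simp add: c3_def add_int_scale)
  have c3: "c3 = f3 + m32' *\<^sub>R f2 + m31' *\<^sub>R f1"
    by (simp add: c3_def m32'_def m31'_def c2(2) b algebra_simps)
  obtain n43 :: int where n43: "\<bar>m43 + of_int n43\<bar> \<le> 1/2" using near by blast
  obtain n42 :: int where n42: "\<bar>(m42 + of_int n43 * m32') + of_int n42\<bar> \<le> 1/2" using near by blast
  obtain n41 :: int where n41: "\<bar>(m41 + of_int n43 * m31' + of_int n42 * m21') + of_int n41\<bar> \<le> 1/2"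
    using near by blast
  define m43' m42' m41' c4 where "m43' = m43 + of_int n43"
    and "m42' = (m42 + of_int n43 * m32') + of_int n42"
    and "m41' = (m41 + of_int n43 * m31' + of_int n42 * m21') + of_int n41"
    and "c4 = b4 + of_int n43 *\<^sub>R c3 + of_int n42 *\<^sub>R c2 + of_int n41 *\<^sub>R b1"
  have c4M: "c4 \<in> M" using M c2(1) c3M by (simp add: c4_def add_int_scale)
  have c4: "c4 = f4 + m43' *\<^sub>R f3 + m42' *\<^sub>R f2 + m41' *\<^sub>R f1"
    by (simp add: c4_def m43'_def m42'_def m41'_def c3 c2(2) b algebra_simps)
  have "gram_schmidt4 b1 c2 c3 c4 f1 f2 f3 f4 m21' m31' m32' m41' m42' m43'"
    using orth b(1) c2(2) c3 c4 by unfold_locales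
  moreover have "{b1, c2, c3, c4} \<subseteq> M" using M c2(1) c3M c4M by auto
  moreover have "\<bar>m21'\<bar> \<le> 1/2" "\<bar>m31'\<bar> \<le> 1/2" "\<bar>m32'\<bar> \<le> 1/2"
    "\<bar>m41'\<bar> \<le> 1/2" "\<bar>m42'\<bar> \<le> 1/2" "\<bar>m43'\<bar> \<le> 1/2"
    using n21 n31 n32 n41 n42 n43
    unfolding m21'_def m31'_def m32'_def m41'_def m42'_def m43'_def by auto
  ultimately show ?thesis by blast
qed

lemma gram2_int: "a \<in> M \<Longrightarrow> b \<in> M \<Longrightarrow> gram2 a b \<in> \<int>"
  unfolding gram2_def power2_eq_square by (intro Ints_diff Ints_mult inner_int)

lemma gram3_int: "a \<in> M \<Longrightarrow> b \<in> M \<Longrightarrow> c \<in> M \<Longrightarrow> gram3 a b c \<in> \<int>"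
  unfolding gram3_def power2_eq_square by (intro Ints_diff Ints_add Ints_mult inner_int Ints_numeral)

text \<open>The potential of the LLL algorithm, the product of the leading Gram determinants; the
  fourth one is held at 5 and left out.\<close>

definition potential :: "'a \<Rightarrow> 'a \<Rightarrow> 'a \<Rightarrow> real" where
  "potential a b c = (a \<bullet> a) * gram2 a b * gram3 a b c"

lemma potential_int: "a \<in> M \<Longrightarrow> b \<in> M \<Longrightarrow> c \<in> M \<Longrightarrow> potential a b c \<in> \<int>"
  unfolding potential_def by (intro Ints_mult inner_int gram2_int gram3_int)

text \<open>The potential takes nonnegative integer values, so a minimum is attained. Taking a
  minimal quadruple replaces running the LLL algorithm until it stops.\<close>

lemma potential_minimal:
  assumes "{a1, a2, a3, a4} \<subseteq> M" "gram4 a1 a2 a3 a4 = 5"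
  shows "\<exists>b1 b2 b3 b4. {b1, b2, b3, b4} \<subseteq> M \<and> gram4 b1 b2 b3 b4 = 5 \<and>
    (\<forall>c1 c2 c3 c4. {c1, c2, c3, c4} \<subseteq> M \<and> gram4 c1 c2 c3 c4 = 5
       \<longrightarrow> potential b1 b2 b3 \<le> potential c1 c2 c3)"
proof -
  let ?P = "\<lambda>(b1, b2, b3, b4). {b1, b2, b3, b4} \<subseteq> M \<and> gram4 b1 b2 b3 b4 = 5"
  let ?f = "\<lambda>(b1, b2, b3, b4). nat \<lfloor>potential b1 b2 b3\<rfloor>"
  have "?P (a1, a2, a3, a4)" using assms by simp
  then obtain b where b: "?P b" "\<And>c. ?P c \<Longrightarrow> ?f b \<le> ?f c"
    using exists_least_iff[of "\<lambda>n. \<exists>b. ?P b \<and> ?f b = n"] by (metis (no_types, lifting) not_le_imp_less)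
  obtain b1 b2 b3 b4 where eq: "b = (b1, b2, b3, b4)" by (cases b)
  have "potential b1 b2 b3 \<le> potential c1 c2 c3" if c: "?P (c1, c2, c3, c4)" for c1 c2 c3 c4
  proof -
    have nonneg: "0 \<le> potential d1 d2 d3" if d: "?P (d1, d2, d3, d4)" for d1 d2 d3 d4
    proof -
      obtain f1 f2 f3 f4 m21 m31 m32 m41 m42 m43
        where "gram_schmidt4 d1 d2 d3 d4 f1 f2 f3 f4 m21 m31 m32 m41 m42 m43"
        using gram_schmidt4_exists[of d1 d2 d3 d4] by blast
      then interpret gram_schmidt4 d1 d2 d3 d4 f1 f2 f3 f4 m21 m31 m32 m41 m42 m43 .
      show ?thesis unfolding potential_def gram2_b gram3_b by simp
    qed
    have "nat \<lfloor>potential b1 b2 b3\<rfloor> \<le> nat \<lfloor>potential c1 c2 c3\<rfloor>" using b(2)[OF c] eq by simp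
    moreover have "potential b1 b2 b3 \<in> \<int>" "potential c1 c2 c3 \<in> \<int>"
      using b(1) c eq by (auto intro: potential_int)
    moreover have "0 \<le> potential b1 b2 b3" "0 \<le> potential c1 c2 c3"
      using nonneg[of b1 b2 b3 b4] nonneg[of c1 c2 c3 c4] b(1) c eq by simp_all
    ultimately show ?thesis by (auto elim!: Ints_cases)
  qed
  then have "{b1, b2, b3, b4} \<subseteq> M \<and> gram4 b1 b2 b3 b4 = 5 \<and>
    (\<forall>c1 c2 c3 c4. {c1, c2, c3, c4} \<subseteq> M \<and> gram4 c1 c2 c3 c4 = 5
       \<longrightarrow> potential b1 b2 b3 \<le> potential c1 c2 c3)"
    using b(1) eq by auto
  then show ?thesis by (intro exI)
qed

end

text \<open>The numbers \<open>Bi\<close> are the squared lengths of the Gram--Schmidt vectors of an LLL-reduced basis; their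
  first partial products are Gram determinants, hence integers.\<close>

lemma lll_bounds:
  fixes B1 B2 B3 B4 :: real and k1 k2 k3 :: int
  assumes pos: "B1 > 0" "B2 > 0" "B3 > 0" "B4 > 0" and prod: "B1 * B2 * B3 * B4 = 5"
    and step: "3 / 4 * B1 \<le> B2" "3 / 4 * B2 \<le> B3" "3 / 4 * B3 \<le> B4"
    and k: "B1 = 2 * k1" "B1 * B2 = k2" "B1 * B2 * B3 = k3"
  shows "B1 = 2" "B2 = 3 / 2" "B3 = 4 / 3" "B4 = 5 / 4"
proof -
  show B1: "B1 = 2"
  proof (rule ccontr)
    assume "B1 \<noteq> 2"
    then have "k1 > 1" using pos k(1) by (cases "k1 = 1") auto
    then have "B1 \<ge> 4" using k(1) by simp
    then have "B1 \<ge> 4" "B2 \<ge> 3" "B3 \<ge> 9 / 4" "B4 \<ge> 27 / 16" using step by auto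
    \<comment> \<open>The lower bounds multiply to more than 45, against a product of 5.\<close>
    then have "4 * 3 * (9 / 4) * (27 / 16) \<le> B1 * B2 * B3 * B4"
      by (intro mult_mono) auto
    then show False using prod by simp
  qed
  show B2: "B2 = 3 / 2"
  proof (rule ccontr)
    assume "B2 \<noteq> 3 / 2"
    then have "k2 \<noteq> 3" using k(2) B1 by auto
    moreover have "k2 \<ge> 3" using step(1) k(2) B1 by simp
    ultimately have "k2 \<ge> 4" by simp
    then have "B2 \<ge> 2" using k(2) B1 by simp
    then have "B2 \<ge> 2" "B3 \<ge> 3 / 2" "B4 \<ge> 9 / 8" using step by auto
    then have "2 * (3 / 2) * (9 / 8) \<le> B2 * B3 * B4" by (intro mult_mono) auto
    then show False using prod B1 by simp
  qed
  show B3: "B3 = 4 / 3"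
  proof (rule ccontr)
    assume "B3 \<noteq> 4 / 3"
    then have "k3 \<noteq> 4" using k(3) B1 B2 by auto
    moreover have "k3 > 3" using step(2) k(3) B1 B2 by simp
    ultimately have "k3 \<ge> 5" by simp
    then have "B3 \<ge> 5 / 3" using k(3) B1 B2 by simp
    then have "B3 \<ge> 5 / 3" "B4 \<ge> 5 / 4" using step by auto
    then have "5 / 3 * (5 / 4) \<le> B3 * B4" by (intro mult_mono) auto
    then show False using prod B1 B2 by simp
  qed
  show "B4 = 5 / 4" using prod B1 B2 B3 by simp
qed

context even_lattice
begin

text \<open>Comparing a quadruple of minimal potential with its swaps of neighbours gives the Lovasz
  conditions with constant 3/4. By \<open>lll_bounds\<close> the Gram--Schmidt norms are then 2,
  3/2, 4/3, 5/4, as for the simple roots of type A of rank 4.\<close>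

lemma reduced_basis:
  assumes "{a1, a2, a3, a4} \<subseteq> M" "gram4 a1 a2 a3 a4 = 5"
  shows "\<exists>b1 b2 b3 b4. {b1, b2, b3, b4} \<subseteq> M \<and> b1 \<bullet> b1 = 2 \<and> b2 \<bullet> b2 = 2 \<and> b3 \<bullet> b3 = 2 \<and> b4 \<bullet> b4 = 2 \<and>
    gram2 b1 b2 = 3 \<and> gram3 b1 b2 b3 = 4 \<and> gram4 b1 b2 b3 b4 = 5"
proof -
  obtain d1 d2 d3 d4 where d: "{d1, d2, d3, d4} \<subseteq> M" "gram4 d1 d2 d3 d4 = 5"
    and min: "\<forall>c1 c2 c3 c4. {c1, c2, c3, c4} \<subseteq> M \<and> gram4 c1 c2 c3 c4 = 5
      \<longrightarrow> potential d1 d2 d3 \<le> potential c1 c2 c3"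
    using potential_minimal[OF assms] by (elim exE conjE) (rule that, assumption+)
  obtain f1 f2 f3 f4 m21 m31 m32 m41 m42 m43
    where gs: "gram_schmidt4 d1 d2 d3 d4 f1 f2 f3 f4 m21 m31 m32 m41 m42 m43"
    using gram_schmidt4_exists[of d1 d2 d3 d4] by blast
  obtain b2 b3 b4 n21 n31 n32 n41 n42 n43 where M: "{d1, b2, b3, b4} \<subseteq> M"
    and gs': "gram_schmidt4 d1 b2 b3 b4 f1 f2 f3 f4 n21 n31 n32 n41 n42 n43"
    and n: "\<bar>n21\<bar> \<le> 1/2" "\<bar>n31\<bar> \<le> 1/2" "\<bar>n32\<bar> \<le> 1/2" "\<bar>n41\<bar> \<le> 1/2" "\<bar>n42\<bar> \<le> 1/2" "\<bar>n43\<bar> \<le> 1/2"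
    using size_reduce[OF gs d(1)] by (elim exE conjE) (rule that, assumption+)
  interpret D: gram_schmidt4 d1 d2 d3 d4 f1 f2 f3 f4 m21 m31 m32 m41 m42 m43 by (fact gs)
  interpret B: gram_schmidt4 d1 b2 b3 b4 f1 f2 f3 f4 n21 n31 n32 n41 n42 n43 by (fact gs')
  let ?B1 = "f1 \<bullet> f1" and ?B2 = "f2 \<bullet> f2" and ?B3 = "f3 \<bullet> f3" and ?B4 = "f4 \<bullet> f4"
  have prod: "?B1 * ?B2 * ?B3 * ?B4 = 5" using D.gram4_b d(2) by simp
  have pos: "?B1 > 0" "?B2 > 0" "?B3 > 0" "?B4 > 0"
    using prod by (auto simp: inner_gt_zero_iff)
  have g4: "gram4 d1 b2 b3 b4 = 5" using B.gram4_b prod by simp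
  \<comment> \<open>The potential depends only on the Gram--Schmidt vectors, so the size-reduced
    quadruple is minimal as well.\<close>
  have pot: "potential d1 d2 d3 = ?B1 * (?B1 * ?B2) * (?B1 * ?B2 * ?B3)"
    unfolding potential_def D.gram2_b D.gram3_b D.inner_b ..
  \<comment> \<open>Swapping the first two vectors replaces the factor
    \<open>f1 \<bullet> f1\<close> by \<open>b2 \<bullet> b2\<close>, whose part along
    \<open>f1\<close> is at most a quarter of \<open>f1 \<bullet> f1\<close>. The other two swaps
    are used in the same way.\<close>
  have "potential d1 d2 d3 \<le> potential b2 d1 b3" using M g4 by (intro min[rule_format, of _ _ _ b4]) (auto simp: gram4_swap)
  also have "potential b2 d1 b3 = (?B2 + n21\<^sup>2 * ?B1) * (?B1 * ?B2) * (?B1 * ?B2 * ?B3)"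
    unfolding potential_def gram2_commute[of b2] gram3_swap(1)[of b2] B.gram2_b B.gram3_b B.inner_b ..
  finally have "?B1 \<le> ?B2 + n21\<^sup>2 * ?B1" using pos unfolding pot by simp
  moreover have sq: "x\<^sup>2 * y \<le> 1 / 4 * y" if "\<bar>x\<bar> \<le> 1 / 2" "y > 0" for x y :: real
  proof -
    have "x\<^sup>2 \<le> (1 / 2)\<^sup>2" using that(1) by (metis abs_le_square_iff abs_of_nonneg zero_le_divide_1_iff zero_le_numeral)
    then show ?thesis using that(2) by (intro mult_right_mono) (auto simp: power2_eq_square)
  qed
  ultimately have s1: "3 / 4 * ?B1 \<le> ?B2" using sq[OF n(1) pos(1)] by simp
  have "potential d1 d2 d3 \<le> potential d1 b3 b2" using M g4 by (intro min[rule_format, of _ _ _ b4]) (auto simp: gram4_swap)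
  also have "potential d1 b3 b2 = ?B1 * (?B1 * (?B3 + n32\<^sup>2 * ?B2)) * (?B1 * ?B2 * ?B3)"
    unfolding potential_def gram3_swap(2)[of _ b3] B.gram2_b_swap B.gram3_b B.inner_b ..
  finally have "?B2 \<le> ?B3 + n32\<^sup>2 * ?B2" using pos unfolding pot by simp
  then have s2: "3 / 4 * ?B2 \<le> ?B3" using sq[OF n(3) pos(2)] by simp
  have "potential d1 d2 d3 \<le> potential d1 b2 b4" using M g4 by (intro min[rule_format, of _ _ _ b3]) (auto simp: gram4_swap)
  also have "potential d1 b2 b4 = ?B1 * (?B1 * ?B2) * (?B1 * ?B2 * (?B4 + n43\<^sup>2 * ?B3))"
    unfolding potential_def B.gram2_b B.gram3_b_swap B.inner_b ..
  finally have "?B3 \<le> ?B4 + n43\<^sup>2 * ?B3" using pos unfolding pot by simp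
  then have s3: "3 / 4 * ?B3 \<le> ?B4" using sq[OF n(6) pos(3)] by simp
  obtain k1 k2 k3 :: int where k: "?B1 = 2 * k1" "?B1 * ?B2 = k2" "?B1 * ?B2 * ?B3 = k3"
    using even[of d1] gram2_int[of d1 b2] gram3_int[of d1 b2 b3] M
    unfolding B.gram2_b B.gram3_b B.inner_b by (auto elim!: Ints_cases)
  note B = lll_bounds[OF pos prod s1 s2 s3 k]
  \<comment> \<open>Size reduction keeps the norms of \<open>b2\<close>, \<open>b3\<close>,
    \<open>b4\<close> below 4, and the only positive even integer there is 2.\<close>
  have norm2: "x \<bullet> x = 2" if x: "x \<in> M" "0 < x \<bullet> x" "x \<bullet> x < 4" for x
  proof -
    obtain k :: int where k: "x \<bullet> x = 2 * of_int k" using even[OF x(1)] by blast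
    then have "0 < k" "k < 2" using x(2,3) by linarith+
    then show ?thesis using k by simp
  qed
  have "d1 \<bullet> d1 = 2" unfolding B.inner_b B ..
  moreover have "b2 \<bullet> b2 = 2"
    using M sq[OF n(1), of ?B1] zero_le_power2[of n21] by (intro norm2) (auto simp: B.inner_b B add_pos_nonneg)
  moreover have "b3 \<bullet> b3 = 2"
    using M sq[OF n(2), of ?B1] sq[OF n(3), of ?B2]
    by (intro norm2) (auto simp: B.inner_b B add_pos_nonneg)
  moreover have "b4 \<bullet> b4 = 2"
    using M sq[OF n(4), of ?B1] sq[OF n(5), of ?B2] sq[OF n(6), of ?B3]
    by (intro norm2) (auto simp: B.inner_b B add_pos_nonneg)
  moreover have "gram2 d1 b2 = 3" "gram3 d1 b2 b3 = 4" unfolding B.gram2_b B.gram3_b B by simp_all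
  ultimately show ?thesis using M g4 by blast
qed

section \<open>Chains of simple roots\<close>

lemma inner_bounded:
  assumes "x \<in> M" "y \<in> M" "x \<bullet> x = 2" "y \<bullet> y = 2"
  shows "x \<bullet> y \<in> {-2, -1, 0, 1, 2}"
proof -
  obtain k :: int where k: "x \<bullet> y = k" using inner_int[OF assms(1,2)] by (auto elim: Ints_cases)
  have "(x \<bullet> y)\<^sup>2 \<le> 2\<^sup>2" using Cauchy_Schwarz_ineq[of x y] assms by simp
  then have "\<bar>x \<bullet> y\<bar> \<le> 2" by (metis abs_le_square_iff abs_numeral)
  then have "-2 \<le> k" "k \<le> 2" unfolding k by (simp_all add: abs_le_iff)
  then have "k = -2 \<or> k = -1 \<or> k = 0 \<or> k = 1 \<or> k = 2" by arith
  then show ?thesis unfolding k by auto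
qed

text \<open>Once \<open>a \<bullet> b = -1\<close>, the third Gram determinant leaves six possible
  pairs of products with \<open>c\<close>. In each, a reordering, a change of sign or the
  subtraction of \<open>b\<close> gives a chain; these changes are unimodular and keep the
  determinant with \<open>d\<close> at 5.\<close>

lemma A3_chain:
  assumes M: "{a, b, c, d} \<subseteq> M" and norm: "a \<bullet> a = 2" "b \<bullet> b = 2" "c \<bullet> c = 2" "d \<bullet> d = 2"
    and g: "gram2 a b = 3" "gram3 a b c = 4" "gram4 a b c d = 5"
  shows "\<exists>u v w. {u, v, w} \<subseteq> M \<and> u \<bullet> u = 2 \<and> v \<bullet> v = 2 \<and> w \<bullet> w = 2 \<and>
    u \<bullet> v = -1 \<and> v \<bullet> w = -1 \<and> u \<bullet> w = 0 \<and> gram4 u v w d = 5"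
proof -
  have wlog: ?thesis if M: "{a, b, c, d} \<subseteq> M" and norm: "a \<bullet> a = 2" "b \<bullet> b = 2" "c \<bullet> c = 2"
    and ab: "a \<bullet> b = -1" and g: "gram3 a b c = 4" "gram4 a b c d = 5" for a b c
  proof -
    have m: "a \<in> M" "b \<in> M" "c \<in> M" using M by auto
    have com: "b \<bullet> a = -1" "c \<bullet> a = a \<bullet> c" "c \<bullet> b = b \<bullet> c" using ab by (simp_all add: inner_commute)
    have "(a \<bullet> c)\<^sup>2 + (b \<bullet> c)\<^sup>2 + (a \<bullet> c) * (b \<bullet> c) = 1"
      using g(1) by (simp add: gram3_def norm ab mult.commute)
    then consider "a \<bullet> c = 0" "b \<bullet> c = -1" | "a \<bullet> c = 0" "b \<bullet> c = 1" | "a \<bullet> c = -1" "b \<bullet> c = 0"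
      | "a \<bullet> c = 1" "b \<bullet> c = 0" | "a \<bullet> c = 1" "b \<bullet> c = -1" | "a \<bullet> c = -1" "b \<bullet> c = 1"
      using inner_bounded[OF m(1,3) norm(1,3)] inner_bounded[OF m(2,3) norm(2,3)] by auto
    then show ?thesis
    proof cases
      case 1
      show ?thesis
        by (rule exI[of _ a], rule exI[of _ b], rule exI[of _ c]) (use g m in \<open>auto simp: norm ab 1 com\<close>)
    next
      case 2
      show ?thesis
        by (rule exI[of _ a], rule exI[of _ b], rule exI[of _ "- c"]) (use g(2) m minus[of c] in \<open>auto simp: norm ab 2 com gram4_minus gram4_swap(1)[of b]\<close>)
    next
      case 3
      show ?thesis
        by (rule exI[of _ b], rule exI[of _ a], rule exI[of _ c]) (use g(2) m in \<open>auto simp: norm ab 3 com gram4_swap\<close>)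
    next
      case 4
      show ?thesis
        by (rule exI[of _ b], rule exI[of _ a], rule exI[of _ "- c"]) (use g(2) m minus[of c] in \<open>auto simp: norm ab 4 com gram4_minus gram4_swap(1)[of b]\<close>)
    next
      case 5
      show ?thesis
        by (rule exI[of _ a], rule exI[of _ b], rule exI[of _ "- c - b"]) (use g(2) m diff[OF minus[of c], of b] minus[of c] in \<open>auto simp: norm ab 5 com gram4_def inner_diff_left inner_diff_right algebra_simps power2_eq_square\<close>)
    next
      case 6
      show ?thesis
        by (rule exI[of _ a], rule exI[of _ b], rule exI[of _ "c - b"]) (use g(2) m diff[of c b] in \<open>auto simp: norm ab 6 com gram4_def inner_diff_left inner_diff_right algebra_simps power2_eq_square\<close>)
    qed
  qed
  have "(a \<bullet> b)\<^sup>2 = 1" using g(1) by (simp add: gram2_def norm)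
  then consider "a \<bullet> b = -1" | "a \<bullet> b = 1" by (auto simp: power2_eq_1_iff)
  then show ?thesis
  proof cases
    case 1
    then show ?thesis using wlog[OF M norm(1-3)] g by blast
  next
    case 2
    show ?thesis
    proof (rule wlog[of a "- b" c])
      show "gram3 a (- b) c = 4" using g(2) by (simp add: gram3_def)
      show "gram4 a (- b) c d = 5" using g(3) by (simp add: gram4_def)
    qed (use M minus norm 2 in auto)
  qed
qed

text \<open>Determinants 4 and 5 give the part of \<open>t\<close> orthogonal to \<open>u\<close>,
  \<open>v\<close>, \<open>w\<close> the norm 5/4, so its projection to their span has norm 3/4. The
  dual of the A3 root lattice has eight vectors of that norm; in each case a change of sign and the
  subtraction of roots attach \<open>t\<close> to an end of the chain.\<close>

lemma A4_chain:
  assumes "{a1, a2, a3, a4} \<subseteq> M" "gram4 a1 a2 a3 a4 = 5"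
  shows "\<exists>u v w x. {u, v, w, x} \<subseteq> M \<and> u \<bullet> u = 2 \<and> v \<bullet> v = 2 \<and> w \<bullet> w = 2 \<and> x \<bullet> x = 2 \<and>
    u \<bullet> v = -1 \<and> v \<bullet> w = -1 \<and> w \<bullet> x = -1 \<and> u \<bullet> w = 0 \<and> u \<bullet> x = 0 \<and> v \<bullet> x = 0"
proof -
  obtain b1 b2 b3 t where b: "{b1, b2, b3, t} \<subseteq> M" "b1 \<bullet> b1 = 2" "b2 \<bullet> b2 = 2" "b3 \<bullet> b3 = 2" and tt: "t \<bullet> t = 2"
    and g: "gram2 b1 b2 = 3" "gram3 b1 b2 b3 = 4" "gram4 b1 b2 b3 t = 5"
    using reduced_basis[OF assms] by blast
  obtain u v w where uvw: "{u, v, w} \<subseteq> M" "u \<bullet> u = 2" "v \<bullet> v = 2" "w \<bullet> w = 2"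
    "u \<bullet> v = -1" "v \<bullet> w = -1" "u \<bullet> w = 0" and g4: "gram4 u v w t = 5"
    using A3_chain[OF b tt g] by blast
  have m: "u \<in> M" "v \<in> M" "w \<in> M" "t \<in> M" using uvw(1) b(1) by auto
  note M = m m[THEN minus] diff
  have com: "v \<bullet> u = -1" "w \<bullet> v = -1" "w \<bullet> u = 0" "t \<bullet> u = u \<bullet> t" "t \<bullet> v = v \<bullet> t" "t \<bullet> w = w \<bullet> t"
    using uvw by (simp_all add: inner_commute)
  \<comment> \<open>Four times the norm of the projection, written with the adjugate of the Gram
    matrix of the chain.\<close>
  have "3 * (u \<bullet> t)\<^sup>2 + 4 * (v \<bullet> t)\<^sup>2 + 3 * (w \<bullet> t)\<^sup>2 + 4 * (u \<bullet> t) * (v \<bullet> t)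
      + 2 * (u \<bullet> t) * (w \<bullet> t) + 4 * (v \<bullet> t) * (w \<bullet> t) = 3"
    using g4 by (simp add: gram4_def uvw tt)
  then consider "u \<bullet> t = 0" "v \<bullet> t = 0" "w \<bullet> t = -1" | "u \<bullet> t = 0" "v \<bullet> t = 0" "w \<bullet> t = 1"
    | "u \<bullet> t = -1" "v \<bullet> t = 0" "w \<bullet> t = 0" | "u \<bullet> t = 1" "v \<bullet> t = 0" "w \<bullet> t = 0"
    | "u \<bullet> t = 0" "v \<bullet> t = 1" "w \<bullet> t = -1" | "u \<bullet> t = 0" "v \<bullet> t = -1" "w \<bullet> t = 1"
    | "u \<bullet> t = 1" "v \<bullet> t = -1" "w \<bullet> t = 0" | "u \<bullet> t = -1" "v \<bullet> t = 1" "w \<bullet> t = 0"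
    using inner_bounded[OF m(1,4) uvw(2) tt] inner_bounded[OF m(2,4) uvw(3) tt]
      inner_bounded[OF m(3,4) uvw(4) tt] by auto
  then show ?thesis
  proof cases
    case 1
    show ?thesis
      by (rule exI[of _ u], rule exI[of _ v], rule exI[of _ w], rule exI[of _ t]) (simp add: M uvw com tt 1)
  next
    case 2
    show ?thesis
      by (rule exI[of _ u], rule exI[of _ v], rule exI[of _ w], rule exI[of _ "- t"]) (simp add: M uvw com tt 2)
  next
    case 3
    show ?thesis
      by (rule exI[of _ t], rule exI[of _ u], rule exI[of _ v], rule exI[of _ w]) (simp add: M uvw com tt 3)
  next
    case 4
    show ?thesis
      by (rule exI[of _ "- t"], rule exI[of _ u], rule exI[of _ v], rule exI[of _ w]) (simp add: M uvw com tt 4)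
  next
    case 5
    show ?thesis
      by (rule exI[of _ "t - v - u"], rule exI[of _ u], rule exI[of _ v], rule exI[of _ w])
         (simp add: M uvw com tt 5 inner_diff_left inner_diff_right)
  next
    case 6
    show ?thesis
      by (rule exI[of _ "- t - v - u"], rule exI[of _ u], rule exI[of _ v], rule exI[of _ w])
         (simp add: M uvw com tt 6 inner_diff_left inner_diff_right)
  next
    case 7
    show ?thesis
      by (rule exI[of _ "t - u"], rule exI[of _ u], rule exI[of _ v], rule exI[of _ w])
         (simp add: M uvw com tt 7 inner_diff_left inner_diff_right)
  next
    case 8
    show ?thesis
      by (rule exI[of _ "- t - u"], rule exI[of _ u], rule exI[of _ v], rule exI[of _ w])
         (simp add: M uvw com tt 8 inner_diff_left inner_diff_right)
  qed
qed

end

section \<open>Construction of multipliers\<close>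

text \<open>The map is given by a formula that is linear everywhere but scales inner products only
  on \<open>E\<close>, a subspace that is easier to describe by equations than
  \<open>span \<Lambda>\<close>.\<close>

lemma has_multiplierI:
  assumes "linear \<sigma>" "\<sigma> ` \<Lambda> \<subseteq> \<Lambda>" "\<Lambda> \<subseteq> E" "subspace E"
    and "\<And>u v. u \<in> E \<Longrightarrow> v \<in> E \<Longrightarrow> \<sigma> u \<bullet> \<sigma> v = c * (u \<bullet> v)"
  shows "has_multiplier \<Lambda> c"
proof -
  have "\<sigma> ` span \<Lambda> \<subseteq> span \<Lambda>"
    using linear_span_image[OF assms(1)] span_mono[OF assms(2)] by metis
  moreover have "span \<Lambda> \<subseteq> E" using assms(3,4) by (rule span_minimal)
  ultimately have "multiplier \<Lambda> c \<sigma>"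
    unfolding multiplier_def similarity_on_def
    using assms(1,2,5) by (auto simp: linear_add linear_scale subset_iff)
  then show ?thesis unfolding has_multiplier_def by blast
qed

lemma has_multiplier_mult:
  assumes "has_multiplier \<Lambda> a" "has_multiplier \<Lambda> b"
  shows "has_multiplier \<Lambda> (a * b)"
proof -
  obtain \<sigma> \<tau> where "multiplier \<Lambda> a \<sigma>" "multiplier \<Lambda> b \<tau>"
    using assms by (auto simp: has_multiplier_def)
  then have "multiplier \<Lambda> (a * b) (\<sigma> \<circ> \<tau>)"
    by (auto simp: multiplier_def similarity_on_def image_subset_iff)
  then show ?thesis by (auto simp: has_multiplier_def)
qed

lemma has_multiplier_square:
  assumes "\<And>x. x \<in> \<Lambda> \<Longrightarrow> m *\<^sub>R x \<in> \<Lambda>"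
  shows "has_multiplier \<Lambda> (m\<^sup>2)"
  using assms
  by (intro has_multiplierI[where \<sigma> = "\<lambda>x. m *\<^sub>R x" and E = UNIV])
     (auto simp: power2_eq_square intro: linear_scale_self bounded_linear.linear bounded_linear_scaleR_right)

section \<open>Multipliers of the integer lattices and of A2\<close>

text \<open>Multiplication by \<open>r + s * i\<close> on the Gaussian integers.\<close>

lemma Z2_multiplier: "has_multiplier Z2_lattice (of_int (binform 0 1 r s))"
proof (rule has_multiplierI[where E = UNIV])
  let ?\<sigma> = "\<lambda>x::real^2. \<chi> i::2. if i = 1 then of_int r * x $ 1 - of_int s * x $ 2
                        else of_int s * x $ 1 + of_int r * x $ 2"
  show "linear ?\<sigma>" by (rule linearI) (simp_all add: vec_eq_iff algebra_simps)
  show "?\<sigma> ` integer_lattice \<subseteq> integer_lattice"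
    by (auto simp: integer_lattice_def forall_2)
  show "?\<sigma> u \<bullet> ?\<sigma> v = of_int (binform 0 1 r s) * (u \<bullet> v)" for u v
    unfolding inner_vec_def sum_2 by (simp add: binform_def algebra_simps power2_eq_square)
qed auto

text \<open>Multiplication by \<open>r + s * i\<close> on three Gaussian coordinates.\<close>

lemma Z6_multiplier: "has_multiplier Z6_lattice (of_int (binform 0 1 r s))"
proof (rule has_multiplierI[where E = UNIV])
  let ?\<sigma> = "\<lambda>x::real^6. \<chi> i::6.
     if i = 1 then of_int r * x $ 1 - of_int s * x $ 2
     else if i = 2 then of_int s * x $ 1 + of_int r * x $ 2
     else if i = 3 then of_int r * x $ 3 - of_int s * x $ 4
     else if i = 4 then of_int s * x $ 3 + of_int r * x $ 4
     else if i = 5 then of_int r * x $ 5 - of_int s * x $ 6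
     else of_int s * x $ 5 + of_int r * x $ 6"
  show "linear ?\<sigma>" by (rule linearI) (simp_all add: vec_eq_iff algebra_simps)
  show "?\<sigma> ` integer_lattice \<subseteq> integer_lattice"
    by (auto simp: integer_lattice_def forall_6)
  show "?\<sigma> u \<bullet> ?\<sigma> v = of_int (binform 0 1 r s) * (u \<bullet> v)" for u v
    unfolding inner_vec_def sum_6 by (simp add: binform_def algebra_simps power2_eq_square)
qed auto

lemma subspace_sum_zero: "subspace {x :: real ^ 'n. (\<Sum>i\<in>UNIV. x $ i) = 0}"
  by (auto simp: subspace_def sum.distrib simp flip: sum_distrib_left)

text \<open>On the plane of coordinate sum zero the cyclic shift of coordinates is a rotation of
  order 3, so the map is multiplication by \<open>r + s * \<omega>\<close>.\<close>

lemma A2_multiplier: "has_multiplier A2_lattice (of_int (binform (-1) 1 r s))"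
proof (rule has_multiplierI)
  \<comment> \<open>Indices are added modulo 3, so the index after 3 is 1.\<close>
  have four: "(4 :: 3) = 1" by simp
  let ?\<sigma> = "\<lambda>x::real^3. \<chi> i. of_int r * x $ i + of_int s * x $ (i + 1)"
  let ?E = "{x :: real ^ 3. (\<Sum>i\<in>UNIV. x $ i) = 0}"
  show "linear ?\<sigma>" by (rule linearI) (simp_all add: vec_eq_iff algebra_simps)
  show "subspace ?E" by (rule subspace_sum_zero)
  show "A2_lattice \<subseteq> ?E" by (auto simp: A_lattice_def)
  have "(\<Sum>i\<in>UNIV. ?\<sigma> x $ i) = (of_int r + of_int s) * (\<Sum>i\<in>UNIV. x $ i)" for x
    by (simp add: sum_3 four algebra_simps)
  then show "?\<sigma> ` A2_lattice \<subseteq> A2_lattice"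
    by (auto simp: A_lattice_def integer_lattice_def)
  show "?\<sigma> u \<bullet> ?\<sigma> v = of_int (binform (-1) 1 r s) * (u \<bullet> v)" if "u \<in> ?E" "v \<in> ?E" for u v
  proof -
    have *: "u $ 3 = - u $ 1 - u $ 2" "v $ 3 = - v $ 1 - v $ 2" using that by (auto simp: sum_3)
    show ?thesis
      unfolding inner_vec_def sum_3 by (simp add: four * binform_def algebra_simps power2_eq_square)
  qed
qed

section \<open>Multipliers of E6\<close>

text \<open>Left multiplication by a Hurwitz unit of order 3 on pairs of quaternions, written for vectors
  whose last three coordinates agree (with the sixth standing for all three).\<close>

definition E6_rotation :: "real ^ 8 \<Rightarrow> real ^ 8" where
  "E6_rotation x = (\<chi> i.
     if i = 1 then (x $ 3 + x $ 4 - x $ 1 - x $ 2) / 2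
     else if i = 2 then (x $ 1 + x $ 4 - x $ 2 - x $ 3) / 2
     else if i = 3 then (x $ 2 + x $ 4 - x $ 3 - x $ 1) / 2
     else if i = 4 then - (x $ 1 + x $ 2 + x $ 3 + x $ 4) / 2
     else if i = 5 then - (x $ 5 + 3 * x $ 6) / 2
     else (x $ 5 - x $ 6) / 2)"

text \<open>Here \<open>h\<close> is any integer, its parity telling integral from half-integral
  vectors; thus sums need no carrying. The eight halves add \<open>4 * h\<close> to the coordinate
  sum and do not affect its parity.\<close>

definition E6_coords :: "real ^ 8 \<Rightarrow> int \<Rightarrow> int \<Rightarrow> int \<Rightarrow> int \<Rightarrow> int \<Rightarrow> int \<Rightarrow> int \<Rightarrow> bool" where
  "E6_coords x a b c d e f h \<longleftrightarrow>
    x $ 1 = a + h / 2 \<and> x $ 2 = b + h / 2 \<and> x $ 3 = c + h / 2 \<and> x $ 4 = d + h / 2 \<and>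
    x $ 5 = e + h / 2 \<and> x $ 6 = f + h / 2 \<and> x $ 7 = x $ 6 \<and> x $ 8 = x $ 6 \<and>
    even (a + b + c + d + e + 3 * f)"

lemma E6_lattice_iff: "x \<in> E6_lattice \<longleftrightarrow> (\<exists>a b c d e f h. E6_coords x a b c d e f h)"
  (is "?L \<longleftrightarrow> ?R")
proof
  assume L: ?L
  have "\<exists>h::int. (h = 0 \<or> h = 1) \<and> (\<forall>i. \<exists>k::int. x $ i = k + h / 2)"
  proof -
    consider "\<forall>i. x $ i \<in> \<int>" | "\<forall>i. x $ i - 1 / 2 \<in> \<int>"
      using L by (auto simp: E6_lattice_def E8_lattice_def)
    then show ?thesis
    proof cases
      case 1
      then show ?thesis by (intro exI[of _ 0]) (auto elim!: Ints_cases)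
    next
      case 2
      then have "\<exists>k::int. x $ i = k + 1 / 2" for i by (metis Ints_cases diff_add_cancel)
      then show ?thesis by (intro exI[of _ 1]) auto
    qed
  qed
  then obtain h k where k: "\<And>i. x $ i = of_int (k i) + of_int h / 2" by metis
  obtain m :: int where "(\<Sum>i\<in>UNIV. x $ i) / 2 = m"
    using L by (auto simp: E6_lattice_def E8_lattice_def elim: Ints_cases)
  moreover have eq: "x $ 7 = x $ 6" "x $ 8 = x $ 6" using L by (auto simp: E6_lattice_def)
  ultimately have "real_of_int (k 1 + k 2 + k 3 + k 4 + k 5 + 3 * k 6 + 4 * h) = real_of_int (2 * m)"
    unfolding sum_8 eq k by simp
  then have "k 1 + k 2 + k 3 + k 4 + k 5 + 3 * k 6 + 4 * h = 2 * m" by (simp only: of_int_eq_iff)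
  then have "even (k 1 + k 2 + k 3 + k 4 + k 5 + 3 * k 6)" by presburger
  then have "E6_coords x (k 1) (k 2) (k 3) (k 4) (k 5) (k 6) h"
    unfolding E6_coords_def using eq k by blast
  then show ?R by blast
next
  assume ?R
  then obtain a b c d e f h where "E6_coords x a b c d e f h" by blast
  then have x: "x $ 1 = a + h / 2" "x $ 2 = b + h / 2" "x $ 3 = c + h / 2"
    "x $ 4 = d + h / 2" "x $ 5 = e + h / 2" "x $ 6 = f + h / 2"
    "x $ 7 = f + h / 2" "x $ 8 = f + h / 2" and ev: "even (a + b + c + d + e + 3 * f)"
    by (simp_all add: E6_coords_def)
  obtain m where m: "a + b + c + d + e + 3 * f = 2 * m" using ev by blast
  have "(\<Sum>i\<in>UNIV. x $ i) / 2 = of_int (a + b + c + d + e + 3 * f) / 2 + of_int (2 * h)"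
    unfolding sum_8 x by simp
  also have "\<dots> = of_int (m + 2 * h)" unfolding m by simp
  finally have sum: "(\<Sum>i\<in>UNIV. x $ i) / 2 \<in> \<int>" by (metis Ints_of_int)
  consider g where "h = 2 * g" | g where "h = 2 * g + 1" by (metis evenE oddE)
  then have "(\<forall>i. x $ i \<in> \<int>) \<or> (\<forall>i. x $ i - 1/2 \<in> \<int>)"
  proof cases
    case 1
    then show ?thesis by (auto simp: forall_8 x)
  next
    case (2 g)
    then have "of_int k + of_int h / 2 - 1 / 2 = (of_int (k + g) :: real)" for k by (simp add: field_simps)
    then have "of_int k + of_int h / 2 - 1 / 2 \<in> (\<int> :: real set)" for k by (metis Ints_of_int)
    then show ?thesis unfolding forall_8 x by blast
  qed
  then show ?L using sum x by (simp add: E6_lattice_def E8_lattice_def)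
qed

lemma E6_lattice_add:
  assumes "x \<in> E6_lattice" "y \<in> E6_lattice"
  shows "x + y \<in> E6_lattice"
proof -
  obtain a b c d e f h a' b' c' d' e' f' h'
    where *: "E6_coords x a b c d e f h" "E6_coords y a' b' c' d' e' f' h'"
    using assms unfolding E6_lattice_iff by blast
  have "(a + a') + (b + b') + (c + c') + (d + d') + (e + e') + 3 * (f + f')
      = (a + b + c + d + e + 3 * f) + (a' + b' + c' + d' + e' + 3 * f')" by simp
  then have "even ((a + a') + (b + b') + (c + c') + (d + d') + (e + e') + 3 * (f + f'))"
    using * by (simp only: E6_coords_def dvd_add)
  then have "E6_coords (x + y) (a + a') (b + b') (c + c') (d + d') (e + e') (f + f') (h + h')"
    using * by (simp add: E6_coords_def add_divide_distrib)
  then show ?thesis unfolding E6_lattice_iff by blast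
qed

lemma E6_lattice_scale:
  assumes "x \<in> E6_lattice"
  shows "of_int r *\<^sub>R x \<in> E6_lattice"
proof -
  obtain a b c d e f h where *: "E6_coords x a b c d e f h"
    using assms unfolding E6_lattice_iff by blast
  have "r * a + r * b + r * c + r * d + r * e + 3 * (r * f) = r * (a + b + c + d + e + 3 * f)"
    by (simp add: algebra_simps)
  then have "even (r * a + r * b + r * c + r * d + r * e + 3 * (r * f))"
    using * by (simp only: E6_coords_def dvd_mult)
  then have "E6_coords (of_int r *\<^sub>R x) (r * a) (r * b) (r * c) (r * d) (r * e) (r * f) (r * h)"
    using * by (simp add: E6_coords_def distrib_left)
  then show ?thesis unfolding E6_lattice_iff by blast
qed

lemma E6_rotation_lattice:
  assumes "x \<in> E6_lattice"
  shows "E6_rotation x \<in> E6_lattice"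
proof -
  obtain a b c d e f h where "E6_coords x a b c d e f h"
    using assms unfolding E6_lattice_iff by blast
  then have x: "x $ 1 = a + h / 2" "x $ 2 = b + h / 2" "x $ 3 = c + h / 2"
    "x $ 4 = d + h / 2" "x $ 5 = e + h / 2" "x $ 6 = f + h / 2"
    and ev: "even (a + b + c + d + e + 3 * f)"
    by (simp_all add: E6_coords_def)
  \<comment> \<open>Each of the first four new coordinates is half of a signed sum of
    \<open>a\<close>, \<open>b\<close>, \<open>c\<close>, \<open>d\<close> plus an integer, so this
    sum decides whether the image is half-integral.\<close>
  define h' where "h' = a + b + c + d"
  obtain m where "a + b + c + d + e + 3 * f = 2 * m" using ev by blast
  then have m: "e = 2 * m - h' - 3 * f" by (simp add: h'_def)
  have a: "a = h' - b - c - d" by (simp add: h'_def)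
  have "(- a - b) + (- b - c) + (- a - c) + (- h' - h) + (- m - h) + 3 * (m - h' - 2 * f)
      = 2 * (d - h - 3 * f + m - 3 * h')" by (simp add: a)
  then have "even ((- a - b) + (- b - c) + (- a - c) + (- h' - h) + (- m - h) + 3 * (m - h' - 2 * f))"
    by simp
  then have "E6_coords (E6_rotation x) (- a - b) (- b - c) (- a - c) (- h' - h) (- m - h) (m - h' - 2 * f) h'"
    unfolding E6_coords_def by (simp add: E6_rotation_def x m a field_simps)
  then show ?thesis unfolding E6_lattice_iff by blast
qed

text \<open>The rotation acts as \<omega>: it is orthogonal, and its sum with its transpose is -1.
  These two identities make \<open>r + s * \<omega>\<close> scale inner products by
  \<open>r\<^sup>2 - r * s + s\<^sup>2\<close>.\<close>

lemma E6_rotation_inner: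
  assumes "u $ 6 = u $ 7" "u $ 7 = u $ 8" "v $ 6 = v $ 7" "v $ 7 = v $ 8"
  shows "E6_rotation u \<bullet> E6_rotation v = u \<bullet> v"
    and "E6_rotation u \<bullet> v + u \<bullet> E6_rotation v = - (u \<bullet> v)"
  using assms unfolding inner_vec_def sum_8 by (simp_all add: E6_rotation_def field_simps)

lemma E6_multiplier: "has_multiplier E6_lattice (of_int (binform (-1) 1 r s))"
proof (rule has_multiplierI)
  let ?\<sigma> = "\<lambda>x. of_int r *\<^sub>R x + of_int s *\<^sub>R E6_rotation x"
  let ?E = "{x :: real ^ 8. x $ 6 = x $ 7 \<and> x $ 7 = x $ 8}"
  show "linear ?\<sigma>" by (rule linearI) (simp_all add: vec_eq_iff E6_rotation_def field_simps)
  show "subspace ?E" by (auto simp: subspace_def)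
  show "E6_lattice \<subseteq> ?E" by (auto simp: E6_lattice_def)
  show "?\<sigma> ` E6_lattice \<subseteq> E6_lattice"
    by (auto intro!: E6_lattice_add E6_lattice_scale E6_rotation_lattice)
  show "?\<sigma> u \<bullet> ?\<sigma> v = of_int (binform (-1) 1 r s) * (u \<bullet> v)" if "u \<in> ?E" "v \<in> ?E" for u v
  proof -
    have *: "E6_rotation u \<bullet> v = - (u \<bullet> v) - u \<bullet> E6_rotation v"
      using E6_rotation_inner(2)[of u v] that by simp
    show ?thesis
      using E6_rotation_inner(1)[of u v] that
      by (simp add: inner_add_left inner_add_right * binform_def algebra_simps power2_eq_square)
  qed
qed

section \<open>Multipliers of A4\<close>

definition int_span4 :: "'a::real_vector \<Rightarrow> 'a \<Rightarrow> 'a \<Rightarrow> 'a \<Rightarrow> 'a set" where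
  "int_span4 a b c d =
    {of_int i *\<^sub>R a + of_int j *\<^sub>R b + of_int k *\<^sub>R c + of_int l *\<^sub>R d | i j k l. True}"

lemma int_span4_even_lattice:
  assumes int: "a \<bullet> b \<in> \<int>" "a \<bullet> c \<in> \<int>" "a \<bullet> d \<in> \<int>" "b \<bullet> c \<in> \<int>" "b \<bullet> d \<in> \<int>" "c \<bullet> d \<in> \<int>"
    and even: "a \<bullet> a / 2 \<in> \<int>" "b \<bullet> b / 2 \<in> \<int>" "c \<bullet> c / 2 \<in> \<int>" "d \<bullet> d / 2 \<in> \<int>"
  shows "even_lattice (int_span4 a b c d)"
proof
  fix x y assume x: "x \<in> int_span4 a b c d"
  then obtain i j k l where xe: "x = of_int i *\<^sub>R a + of_int j *\<^sub>R b + of_int k *\<^sub>R c + of_int l *\<^sub>R d"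
    by (auto simp: int_span4_def)
  have "- x = of_int (- i) *\<^sub>R a + of_int (- j) *\<^sub>R b + of_int (- k) *\<^sub>R c + of_int (- l) *\<^sub>R d"
    by (simp add: xe)
  then show "- x \<in> int_span4 a b c d" unfolding int_span4_def by blast
  obtain nab nac nad nbc nbd ncd :: int where n: "a \<bullet> b = nab" "a \<bullet> c = nac" "a \<bullet> d = nad"
    "b \<bullet> c = nbc" "b \<bullet> d = nbd" "c \<bullet> d = ncd"
    using int by (auto elim!: Ints_cases)
  obtain na nb nc nd :: int where "a \<bullet> a / 2 = na" "b \<bullet> b / 2 = nb" "c \<bullet> c / 2 = nc" "d \<bullet> d / 2 = nd"
    using even by (metis Ints_cases)
  then have n': "a \<bullet> a = 2 * na" "b \<bullet> b = 2 * nb" "c \<bullet> c = 2 * nc" "d \<bullet> d = 2 * nd" by simp_all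
  have com: "b \<bullet> a = nab" "c \<bullet> a = nac" "d \<bullet> a = nad" "c \<bullet> b = nbc" "d \<bullet> b = nbd" "d \<bullet> c = ncd"
    using n by (simp_all add: inner_commute)
  have "x \<bullet> x = 2 * of_int (i * i * na + j * j * nb + k * k * nc + l * l * nd + i * j * nab + i * k * nac
      + i * l * nad + j * k * nbc + j * l * nbd + k * l * ncd)"
    by (simp add: xe inner_add_left inner_add_right n n' com algebra_simps)
  then show "\<exists>k::int. x \<bullet> x = 2 * k" by blast
  assume "y \<in> int_span4 a b c d"
  then obtain i' j' k' l' where ye: "y = of_int i' *\<^sub>R a + of_int j' *\<^sub>R b + of_int k' *\<^sub>R c + of_int l' *\<^sub>R d"
    by (auto simp: int_span4_def)
  have "x + y = of_int (i + i') *\<^sub>R a + of_int (j + j') *\<^sub>R b + of_int (k + k') *\<^sub>R c + of_int (l + l') *\<^sub>R d"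
    by (simp add: xe ye algebra_simps)
  then show "x + y \<in> int_span4 a b c d" unfolding int_span4_def by blast
  show "x \<bullet> y \<in> \<int>"
    by (simp add: xe ye inner_add_left inner_add_right n n' com)
qed

lemma A_lattice_add: "x \<in> A_lattice \<Longrightarrow> y \<in> A_lattice \<Longrightarrow> x + y \<in> A_lattice"
  and A_lattice_scale: "x \<in> A_lattice \<Longrightarrow> of_int n *\<^sub>R x \<in> A_lattice"
  by (auto simp: A_lattice_def integer_lattice_def sum.distrib simp flip: sum_distrib_left)

text \<open>The vectors have \<open>c\<close> times the Gram matrix of the simple roots
  \<open>axis i 1 - axis (i + 1) 1\<close>, so sending these roots to them is a similarity.\<close>

lemma A4_multiplier_of_chain:
  assumes w: "{w1, w2, w3, w4} \<subseteq> A4_lattice"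
    and norm: "w1 \<bullet> w1 = 2 * c" "w2 \<bullet> w2 = 2 * c" "w3 \<bullet> w3 = 2 * c" "w4 \<bullet> w4 = 2 * c"
    and inner: "w1 \<bullet> w2 = - c" "w2 \<bullet> w3 = - c" "w3 \<bullet> w4 = - c" "w1 \<bullet> w3 = 0" "w1 \<bullet> w4 = 0" "w2 \<bullet> w4 = 0"
  shows "has_multiplier A4_lattice c"
proof (rule has_multiplierI)
  \<comment> \<open>The partial sums of coordinates are the coefficients of \<open>x\<close> in the
    simple roots.\<close>
  let ?\<sigma> = "\<lambda>x::real^5. x $ 1 *\<^sub>R w1 + (x $ 1 + x $ 2) *\<^sub>R w2 + (x $ 1 + x $ 2 + x $ 3) *\<^sub>R w3
      + (x $ 1 + x $ 2 + x $ 3 + x $ 4) *\<^sub>R w4"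
  let ?E = "{x :: real ^ 5. (\<Sum>i\<in>UNIV. x $ i) = 0}"
  show "linear ?\<sigma>" by (rule linearI) (simp_all add: algebra_simps)
  show "subspace ?E" by (rule subspace_sum_zero)
  show "A4_lattice \<subseteq> ?E" by (auto simp: A_lattice_def)
  show "?\<sigma> ` A4_lattice \<subseteq> A4_lattice"
  proof clarify
    fix x :: "real ^ 5" assume "x \<in> A4_lattice"
    then have "\<forall>i. \<exists>k::int. x $ i = of_int k"
      by (auto simp: A_lattice_def integer_lattice_def elim: Ints_cases)
    then obtain k where k: "\<And>i. x $ i = of_int (k i)" by metis
    have "?\<sigma> x = of_int (k 1) *\<^sub>R w1 + of_int (k 1 + k 2) *\<^sub>R w2 + of_int (k 1 + k 2 + k 3) *\<^sub>R w3
      + of_int (k 1 + k 2 + k 3 + k 4) *\<^sub>R w4" by (simp add: k)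
    also have "\<dots> \<in> A4_lattice" using w by (intro A_lattice_add A_lattice_scale) auto
    finally show "?\<sigma> x \<in> A4_lattice" .
  qed
  have com: "w2 \<bullet> w1 = - c" "w3 \<bullet> w2 = - c" "w4 \<bullet> w3 = - c" "w3 \<bullet> w1 = 0" "w4 \<bullet> w1 = 0" "w4 \<bullet> w2 = 0"
    using inner by (simp_all add: inner_commute)
  show "?\<sigma> u \<bullet> ?\<sigma> v = c * (u \<bullet> v)" if "u \<in> ?E" "v \<in> ?E" for u v
  proof -
    have *: "u $ 5 = - u $ 1 - u $ 2 - u $ 3 - u $ 4" "v $ 5 = - v $ 1 - v $ 2 - v $ 3 - v $ 4"
      using that by (auto simp: sum_5)
    have uv: "u \<bullet> v = u $ 1 * v $ 1 + u $ 2 * v $ 2 + u $ 3 * v $ 3 + u $ 4 * v $ 4 + u $ 5 * v $ 5"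
      by (simp add: inner_vec_def sum_5)
    show ?thesis
      unfolding uv * by (simp add: inner_add_left inner_add_right norm inner com algebra_simps)
  qed
qed

text \<open>The squares of \<open>0, ..., (p - 1) / 2\<close> are distinct modulo \<open>p\<close>,
  and so are the numbers \<open>- 1 - x\<^sup>2\<close>. Two sets of \<open>(p + 1) / 2\<close>
  residues must meet.\<close>

lemma sum_two_squares_minus_one:
  assumes "prime p" "p \<noteq> (2::nat)"
  shows "\<exists>\<alpha> \<beta> :: int. int p dvd \<alpha>\<^sup>2 + \<beta>\<^sup>2 + 1"
proof -
  define h where "h = (p - 1) div 2"
  have p: "p = 2 * h + 1" "h > 0"
    using prime_odd_nat[OF assms(1)] assms prime_ge_2_nat[OF assms(1)] unfolding h_def
    by (auto elim!: oddE)
  define sq where "sq x = (int x)\<^sup>2 mod int p" for x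
  define sq' where "sq' x = (- 1 - (int x)\<^sup>2) mod int p" for x
  have inj: "x = y" if "x \<le> h" "y \<le> h" "int p dvd (int x)\<^sup>2 - (int y)\<^sup>2" for x y
  proof -
    have "int p dvd (int x - int y) * (int x + int y)"
      using that(3) by (simp add: power2_eq_square algebra_simps)
    then consider "int p dvd int x - int y" | "int p dvd int x + int y"
      using assms(1) prime_dvd_mult_iff by (metis prime_nat_int_transfer)
    then show ?thesis
    proof cases
      case 1
      have "int x - int y = 0"
      proof (rule ccontr)
        assume "int x - int y \<noteq> 0"
        then have "\<bar>int p\<bar> \<le> \<bar>int x - int y\<bar>" using 1 by (rule dvd_imp_le_int)
        then show False using that(1,2) p by linarith
      qed
      then show ?thesis by simp
    next
      case 2
      then show ?thesis using that(1,2) p zdvd_not_zless[of "int x + int y" "int p"] by force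
    qed
  qed
  have "inj_on sq {..h}" "inj_on sq' {..h}"
    using inj by (auto intro!: inj_onI simp: sq_def sq'_def mod_eq_dvd_iff) (metis dvd_diff_commute)
  then have "card (sq ` {..h}) = Suc h" "card (sq' ` {..h}) = Suc h" by (simp_all add: card_image)
  moreover have "card (sq ` {..h} \<union> sq' ` {..h}) \<le> card {0..<int p}"
    by (rule card_mono) (use p in \<open>auto simp: sq_def sq'_def\<close>)
  ultimately have "sq ` {..h} \<inter> sq' ` {..h} \<noteq> {}"
    using p card_Un_disjoint[of "sq ` {..h}" "sq' ` {..h}"] by auto
  then obtain x y where "sq x = sq' y" by auto
  then have "int p dvd (int x)\<^sup>2 + (int y)\<^sup>2 + 1"
    by (simp add: sq_def sq'_def mod_eq_dvd_iff algebra_simps)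
  then show ?thesis by blast
qed

text \<open>The three expressions are half of \<open>u \<bullet> u\<close>, half of \<open>v \<bullet> v\<close>, and \<open>u \<bullet> v\<close> for the vectors
  \<open>u = e + A d1 + B d2\<close> and \<open>v = f + C d1 + D d2\<close> in the proof of \<open>A4_multiplier_prime\<close>. Completing the
  squares, one needs \<open>X = (2A - 1, 2B + 1)\<close> and \<open>Y = (2C, 2D - 1)\<close> with \<open>X \<bullet> X = -2\<close>, \<open>Y \<bullet> Y = -3\<close>, \<open>X \<bullet> Y = 1\<close>
  modulo \<open>p\<close>. Take \<open>Y = (- X + \<surd>5 X') / 2\<close> with \<open>X'\<close> orthogonal to \<open>X\<close> and of the same norm.\<close>

lemma A4_isotropic_coefficients:
  assumes "prime p" "p \<noteq> (2::nat)" "QuadRes (int p) 5"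
  shows "\<exists>A B C D :: int. int p dvd 1 + A\<^sup>2 + B\<^sup>2 - A + B \<and> int p dvd 1 + C\<^sup>2 + D\<^sup>2 - D \<and>
    int p dvd 2 * A * C + 2 * B * D - C + D - B - 1"
proof -
  let ?p = "int p"
  obtain g where "[g\<^sup>2 = 5] (mod ?p)" using assms(3) by (auto simp: QuadRes_def)
  then have g: "[g * g = 5] (mod ?p)" by (simp add: power2_eq_square)
  obtain \<alpha> \<beta> where "?p dvd \<alpha>\<^sup>2 + \<beta>\<^sup>2 + 1" using sum_two_squares_minus_one assms by blast
  then have ab: "[\<alpha> * \<alpha> + \<beta> * \<beta> = - 1] (mod ?p)" by (simp add: cong_iff_dvd_diff power2_eq_square)
  have odd: "odd p" using assms by (metis prime_odd_nat prime_ge_2_nat le_neq_implies_less)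
  obtain h where "2 * h = ?p + 1" using odd by (metis evenE even_plus_one_iff of_nat_Suc even_of_nat Suc_eq_plus1 of_nat_1 of_nat_add)
  then have h: "[2 * h = 1] (mod ?p)" by (simp add: cong_def)
  \<comment> \<open>The squares add up to \<open>2 * (\<alpha>\<^sup>2 + \<beta>\<^sup>2)\<close>,
    which is -2 modulo \<open>p\<close>.\<close>
  define X1 X2 where "X1 = \<alpha> + \<beta>" and "X2 = \<alpha> - \<beta>"
  define Y1 Y2 where "Y1 = h * (- X1 - g * X2)" and "Y2 = h * (- X2 + g * X1)"
  have two: "?p dvd x" if "?p dvd 2 * x" for x
  proof -
    have "coprime ?p 2" using odd by simp
    then show ?thesis using that by (simp add: coprime_dvd_mult_right_iff)
  qed
  define A B C D where "A = h * (X1 + 1)" and "B = h * (X2 - 1)" and "C = h * Y1" and "D = h * (Y2 + 1)"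
  have hh: "[2 * (h * x) = x] (mod ?p)" for x
    using cong_scalar_right[OF h, of x] by (simp add: mult.assoc)
  have X: "[2 * A - 1 = X1] (mod ?p)" "[2 * B + 1 = X2] (mod ?p)"
    using cong_diff[OF hh[of "X1 + 1"] cong_refl[of 1]] cong_add[OF hh[of "X2 - 1"] cong_refl[of 1]]
    by (simp_all add: A_def B_def)
  have Y: "[2 * C = Y1] (mod ?p)" "[2 * D - 1 = Y2] (mod ?p)"
    using hh[of Y1] cong_diff[OF hh[of "Y2 + 1"] cong_refl[of 1]] by (simp_all add: C_def D_def)
  have Y': "[2 * Y1 = - X1 - g * X2] (mod ?p)" "[2 * Y2 = - X2 + g * X1] (mod ?p)"
    using hh unfolding Y1_def Y2_def by blast+
  have XX: "[X1 * X1 + X2 * X2 = - 2] (mod ?p)"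
    using cong_scalar_left[OF ab, of 2] by (simp add: X1_def X2_def algebra_simps)
  have 1: "[(2 * A - 1) * (2 * A - 1) + (2 * B + 1) * (2 * B + 1) = - 2] (mod ?p)"
    by (rule cong_trans[OF cong_add[OF cong_mult[OF X(1) X(1)] cong_mult[OF X(2) X(2)]] XX])
  have "[(2 * Y1) * (2 * Y1) + (2 * Y2) * (2 * Y2) = (- X1 - g * X2) * (- X1 - g * X2) + (- X2 + g * X1) * (- X2 + g * X1)] (mod ?p)"
    by (intro cong_add cong_mult Y')
  also have "(- X1 - g * X2) * (- X1 - g * X2) + (- X2 + g * X1) * (- X2 + g * X1) = (1 + g * g) * (X1 * X1 + X2 * X2)"
    by (simp add: algebra_simps)
  also have "[\<dots> = (1 + 5) * (- 2)] (mod ?p)" by (intro cong_mult cong_add cong_refl g XX)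
  finally have "?p dvd (2 * Y1) * (2 * Y1) + (2 * Y2) * (2 * Y2) - (1 + 5) * (- 2)"
    unfolding cong_iff_dvd_diff .
  also have "(2 * Y1) * (2 * Y1) + (2 * Y2) * (2 * Y2) - (1 + 5) * (- 2) = 2 * (2 * (Y1 * Y1 + Y2 * Y2 - (- 3)))"
    by (simp add: algebra_simps)
  finally have YY: "[Y1 * Y1 + Y2 * Y2 = - 3] (mod ?p)" unfolding cong_iff_dvd_diff by (rule two[OF two])
  have 2: "[(2 * C) * (2 * C) + (2 * D - 1) * (2 * D - 1) = - 3] (mod ?p)"
    by (rule cong_trans[OF cong_add[OF cong_mult[OF Y(1) Y(1)] cong_mult[OF Y(2) Y(2)]] YY])
  have "[X1 * (2 * Y1) + X2 * (2 * Y2) = X1 * (- X1 - g * X2) + X2 * (- X2 + g * X1)] (mod ?p)"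
    by (intro cong_add cong_mult Y' cong_refl)
  also have "X1 * (- X1 - g * X2) + X2 * (- X2 + g * X1) = - (X1 * X1 + X2 * X2)" by (simp add: algebra_simps)
  also have "[\<dots> = - (- 2)] (mod ?p)" using XX by (simp only: cong_minus_minus_iff)
  finally have "?p dvd X1 * (2 * Y1) + X2 * (2 * Y2) - (- (- 2))" unfolding cong_iff_dvd_diff .
  also have "X1 * (2 * Y1) + X2 * (2 * Y2) - (- (- 2)) = 2 * (X1 * Y1 + X2 * Y2 - 1)"
    by (simp add: algebra_simps)
  finally have XY: "[X1 * Y1 + X2 * Y2 = 1] (mod ?p)" unfolding cong_iff_dvd_diff by (rule two)
  have 3: "[(2 * A - 1) * (2 * C) + (2 * B + 1) * (2 * D - 1) = 1] (mod ?p)"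
    by (rule cong_trans[OF cong_add[OF cong_mult[OF X(1) Y(1)] cong_mult[OF X(2) Y(2)]] XY])
  have "2 * (2 * (1 + A\<^sup>2 + B\<^sup>2 - A + B)) = (2 * A - 1) * (2 * A - 1) + (2 * B + 1) * (2 * B + 1) - (- 2)"
    "2 * (2 * (1 + C\<^sup>2 + D\<^sup>2 - D)) = (2 * C) * (2 * C) + (2 * D - 1) * (2 * D - 1) - (- 3)"
    "2 * (2 * A * C + 2 * B * D - C + D - B - 1) = (2 * A - 1) * (2 * C) + (2 * B + 1) * (2 * D - 1) - 1"
    by (simp_all add: algebra_simps power2_eq_square)
  then have "?p dvd 2 * (2 * (1 + A\<^sup>2 + B\<^sup>2 - A + B))" "?p dvd 2 * (2 * (1 + C\<^sup>2 + D\<^sup>2 - D))"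
    "?p dvd 2 * (2 * A * C + 2 * B * D - C + D - B - 1)"
    using 1 2 3 unfolding cong_iff_dvd_diff by (simp_all only:)
  then show ?thesis using two by blast
qed

text \<open>The vectors \<open>u\<close> and \<open>v\<close> span a totally isotropic plane modulo
  \<open>p\<close>. Together with \<open>p * d1\<close> and \<open>p * d2\<close> they generate its
  preimage; a chain in the scaled lattice, scaled back by \<open>sqrt p\<close>, is the image of the
  simple roots.\<close>

lemma A4_multiplier_prime:
  assumes "prime p" "p \<noteq> (2::nat)" "QuadRes (int p) 5"
  shows "has_multiplier A4_lattice (real p)"
proof -
  obtain A B C D :: int where dvd: "int p dvd 1 + A\<^sup>2 + B\<^sup>2 - A + B" "int p dvd 1 + C\<^sup>2 + D\<^sup>2 - D"
    "int p dvd 2 * A * C + 2 * B * D - C + D - B - 1"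
    using A4_isotropic_coefficients[OF assms] by blast
  obtain q1 where q1: "1 + A\<^sup>2 + B\<^sup>2 - A + B = int p * q1" using dvd(1) by blast
  obtain q2 where q2: "1 + C\<^sup>2 + D\<^sup>2 - D = int p * q2" using dvd(2) by blast
  obtain q3 where q3: "2 * A * C + 2 * B * D - C + D - B - 1 = int p * q3" using dvd(3) by blast
  have r1: "1 + (of_int A)\<^sup>2 + (of_int B)\<^sup>2 - of_int A + of_int B = real p * of_int q1"
    using arg_cong[OF q1, of real_of_int] by simp
  have r2: "1 + (of_int C)\<^sup>2 + (of_int D)\<^sup>2 - of_int D = real p * of_int q2"
    using arg_cong[OF q2, of real_of_int] by simp
  have r3: "2 * of_int A * of_int C + 2 * of_int B * of_int D - of_int C + of_int D - of_int B - 1 = real p * of_int q3"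
    using arg_cong[OF q3, of real_of_int] by simp
  \<comment> \<open>A basis of \<open>A4_lattice\<close> in which \<open>d1\<close> and
    \<open>d2\<close> are orthogonal of equal norm, so that the conditions on \<open>A\<close>,
    \<open>B\<close>, \<open>C\<close>, \<open>D\<close> become sums of two squares.\<close>
  define d1 d2 e f :: "real ^ 5" where "d1 = axis 1 1 - axis 2 1" and "d2 = axis 3 1 - axis 4 1"
    and "e = axis 2 1 - axis 4 1" and "f = axis 4 1 - axis 5 1"
  have root: "axis i 1 - axis j 1 \<in> (A_lattice :: (real ^ 5) set)" for i j
    by (auto simp: A_lattice_def integer_lattice_def axis_def sum_subtractf)
  then have mem: "d1 \<in> A_lattice" "d2 \<in> A_lattice" "e \<in> A_lattice" "f \<in> A_lattice"
    by (simp_all add: d1_def d2_def e_def f_def)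
  have inner: "d1 \<bullet> d1 = 2" "d2 \<bullet> d2 = 2" "e \<bullet> e = 2" "f \<bullet> f = 2" "d1 \<bullet> d2 = 0" "d1 \<bullet> e = -1" "d1 \<bullet> f = 0"
    "d2 \<bullet> e = 1" "d2 \<bullet> f = -1" "e \<bullet> f = -1" "d2 \<bullet> d1 = 0" "e \<bullet> d1 = -1" "f \<bullet> d1 = 0" "e \<bullet> d2 = 1"
    "f \<bullet> d2 = -1" "f \<bullet> e = -1"
    by (simp_all add: d1_def d2_def e_def f_def inner_diff_left inner_diff_right inner_axis_axis)
  define u v where "u = e + of_int A *\<^sub>R d1 + of_int B *\<^sub>R d2" and "v = f + of_int C *\<^sub>R d1 + of_int D *\<^sub>R d2"
  have p0: "real p > 0" using assms(1) prime_gt_0_nat by simp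
  have uu: "u \<bullet> u = 2 * real p * of_int q1"
    unfolding u_def mult.assoc r1[symmetric]
    by (simp add: inner inner_add_left inner_add_right power2_eq_square algebra_simps)
  have vv: "v \<bullet> v = 2 * real p * of_int q2"
    unfolding v_def mult.assoc r2[symmetric]
    by (simp add: inner inner_add_left inner_add_right power2_eq_square algebra_simps)
  have uv: "u \<bullet> v = real p * of_int q3"
    unfolding u_def v_def r3[symmetric]
    by (simp add: inner inner_add_left inner_add_right power2_eq_square algebra_simps)
  have ud: "u \<bullet> d1 = of_int (2 * A - 1)" "u \<bullet> d2 = of_int (2 * B + 1)"
    "v \<bullet> d1 = of_int (2 * C)" "v \<bullet> d2 = of_int (2 * D - 1)"
    by (simp_all add: u_def v_def inner inner_add_left)
  then have du: "d1 \<bullet> u = of_int (2 * A - 1)" "d2 \<bullet> u = of_int (2 * B + 1)"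
    "d1 \<bullet> v = of_int (2 * C)" "d2 \<bullet> v = of_int (2 * D - 1)"
    by (simp_all add: inner_commute)
  define t where "t = 1 / sqrt (real p)"
  have t2: "t * t = 1 / real p" using p0 by (simp add: t_def)
  have tt: "(t *\<^sub>R x) \<bullet> (t *\<^sub>R y) = (x \<bullet> y) / real p" for x y :: "real ^ 5"
    using t2 by (simp flip: mult.assoc)
  have t0: "sqrt (real p) *\<^sub>R (t *\<^sub>R x) = x" for x :: "real ^ 5" using p0 by (simp add: t_def)
  let ?a = "t *\<^sub>R (real p *\<^sub>R d1)" and ?b = "t *\<^sub>R (real p *\<^sub>R d2)" and ?c = "t *\<^sub>R u" and ?d = "t *\<^sub>R v"
  have even: "even_lattice (int_span4 ?a ?b ?c ?d)"
    by (rule int_span4_even_lattice; unfold tt) (use p0 in \<open>simp_all add: uu vv uv du inner\<close>)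
  interpret even_lattice "int_span4 ?a ?b ?c ?d" by (rule even)
  have "of_int 1 *\<^sub>R ?a + of_int 0 *\<^sub>R ?b + of_int 0 *\<^sub>R ?c + of_int 0 *\<^sub>R ?d \<in> int_span4 ?a ?b ?c ?d"
    "of_int 0 *\<^sub>R ?a + of_int 1 *\<^sub>R ?b + of_int 0 *\<^sub>R ?c + of_int 0 *\<^sub>R ?d \<in> int_span4 ?a ?b ?c ?d"
    "of_int 0 *\<^sub>R ?a + of_int 0 *\<^sub>R ?b + of_int 1 *\<^sub>R ?c + of_int 0 *\<^sub>R ?d \<in> int_span4 ?a ?b ?c ?d"
    "of_int 0 *\<^sub>R ?a + of_int 0 *\<^sub>R ?b + of_int 0 *\<^sub>R ?c + of_int 1 *\<^sub>R ?d \<in> int_span4 ?a ?b ?c ?d"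
    unfolding int_span4_def by blast+
  then have sub: "{?a, ?b, ?c, ?d} \<subseteq> int_span4 ?a ?b ?c ?d" by simp
  \<comment> \<open>Scaling four vectors by \<open>1 / sqrt p\<close> divides the determinant by
    \<open>p ^ 4\<close>, and the factors \<open>p\<close> at \<open>d1\<close> and
    \<open>d2\<close> restore it.\<close>
  have "gram4 ?a ?b ?c ?d = gram4 d1 d2 e f"
  proof -
    have sc: "gram4 ?a ?b ?c ?d = gram4 d1 d2 u v"
      unfolding gram4_def tt using p0 by (simp add: field_simps power2_eq_square)
    also have "\<dots> = gram4 d1 d2 e f"
      unfolding u_def v_def gram4_add' ..
    finally show ?thesis .
  qed
  also have "\<dots> = 5" by (simp add: gram4_def inner)
  finally obtain x y z w where xyzw: "{x, y, z, w} \<subseteq> int_span4 ?a ?b ?c ?d"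
    "x \<bullet> x = 2" "y \<bullet> y = 2" "z \<bullet> z = 2" "w \<bullet> w = 2"
    "x \<bullet> y = -1" "y \<bullet> z = -1" "z \<bullet> w = -1" "x \<bullet> z = 0" "x \<bullet> w = 0" "y \<bullet> w = 0"
    using A4_chain[OF sub] by blast
  have scaled: "sqrt (real p) *\<^sub>R x \<in> A_lattice" if x: "x \<in> int_span4 ?a ?b ?c ?d" for x
  proof -
    obtain i j k l where "x = of_int i *\<^sub>R ?a + of_int j *\<^sub>R ?b + of_int k *\<^sub>R ?c + of_int l *\<^sub>R ?d"
      using x by (auto simp: int_span4_def)
    then have "sqrt (real p) *\<^sub>R x = of_int i *\<^sub>R (sqrt (real p) *\<^sub>R ?a) + of_int j *\<^sub>R (sqrt (real p) *\<^sub>R ?b)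
      + of_int k *\<^sub>R (sqrt (real p) *\<^sub>R ?c) + of_int l *\<^sub>R (sqrt (real p) *\<^sub>R ?d)"
      by (simp add: scaleR_add_right mult_ac)
    also have "\<dots> = of_int (i * int p) *\<^sub>R d1 + of_int (j * int p) *\<^sub>R d2 + of_int k *\<^sub>R u + of_int l *\<^sub>R v"
      unfolding t0 by simp
    also have "\<dots> \<in> A_lattice"
      unfolding u_def v_def using mem by (intro A_lattice_add A_lattice_scale)
    finally show ?thesis .
  qed
  have ss: "(sqrt (real p) *\<^sub>R x) \<bullet> (sqrt (real p) *\<^sub>R y) = real p * (x \<bullet> y)" for x y :: "real ^ 5"
    by (simp flip: mult.assoc)
  show ?thesis
  proof (rule A4_multiplier_of_chain)
    show "{sqrt (real p) *\<^sub>R x, sqrt (real p) *\<^sub>R y, sqrt (real p) *\<^sub>R z, sqrt (real p) *\<^sub>R w} \<subseteq> A4_lattice"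
      using xyzw(1) scaled by auto
  qed (simp_all add: ss xyzw del: inner_scaleR_left inner_scaleR_right)
qed

lemma A4_multiplier:
  assumes "c > 0" "\<And>p. inert 1 (-1) p \<Longrightarrow> even (multiplicity p c)"
  shows "has_multiplier A4_lattice (real c)"
proof (rule induct_inert_even[OF assms(2,1)])
  show "has_multiplier A4_lattice (real 1)"
    using has_multiplier_square[of A4_lattice 1] by simp
  show "has_multiplier A4_lattice (real (m * n))"
    if "has_multiplier A4_lattice (real m)" "has_multiplier A4_lattice (real n)" for m n
    using has_multiplier_mult[OF that] by simp
  show "has_multiplier A4_lattice (real p)" if "prime p" "\<not> inert 1 (-1) p" for p
  proof -
    \<comment> \<open>2 is inert for the golden form, so only odd primes remain.\<close>
    have "p \<noteq> 2" using that inert_2(2) by auto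
    moreover have "\<exists>a. int p dvd a\<^sup>2 + 1 * a + - 1" using that by (auto simp: inert_def)
    then have "QuadRes (int p) 5" using ex_square_root_shift[OF that(1) \<open>p \<noteq> 2\<close>, of 1 "-1"] by simp
    ultimately show ?thesis using A4_multiplier_prime that(1) by blast
  qed
  show "has_multiplier A4_lattice (real (p\<^sup>2))" for p
    unfolding of_nat_power by (rule has_multiplier_square) (metis A_lattice_scale of_int_of_nat_eq)
qed

section \<open>The three equivalences\<close>

theorem theorem2:
  fixes c :: nat
  assumes "c > 0"
  shows
    "((has_multiplier Z2_lattice (real c) \<longleftrightarrow>
         (\<exists>r s :: int. int c = r\<^sup>2 + s\<^sup>2)) \<and>
      (has_multiplier Z6_lattice (real c) \<longleftrightarrow>
         (\<exists>r s :: int. int c = r\<^sup>2 + s\<^sup>2)) \<and>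
      ((\<exists>r s :: int. int c = r\<^sup>2 + s\<^sup>2) \<longleftrightarrow>
         (\<forall>p :: nat. prime p \<and> [p = 3] (mod 4) \<longrightarrow> even (multiplicity p c)))) \<and>
     ((has_multiplier A2_lattice (real c) \<longleftrightarrow>
         (\<exists>r s :: int. int c = r\<^sup>2 - r * s + s\<^sup>2)) \<and>
      (has_multiplier E6_lattice (real c) \<longleftrightarrow>
         (\<exists>r s :: int. int c = r\<^sup>2 - r * s + s\<^sup>2)) \<and>
      ((\<exists>r s :: int. int c = r\<^sup>2 - r * s + s\<^sup>2) \<longleftrightarrow>
         (\<forall>p :: nat. prime p \<and> [p = 2] (mod 3) \<longrightarrow> even (multiplicity p c)))) \<and>
     ((has_multiplier A4_lattice (real c) \<longleftrightarrow>
         (\<exists>r s :: int. int c = r\<^sup>2 + r * s - s\<^sup>2)) \<and>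
      ((\<exists>r s :: int. int c = r\<^sup>2 + r * s - s\<^sup>2) \<longleftrightarrow>
         (\<forall>p :: nat. prime p \<and> ([int p = 2] (mod 5) \<or> [int p = -2] (mod 5)) \<longrightarrow>
            even (multiplicity p c))))"
proof -
  have form: "r\<^sup>2 + s\<^sup>2 = binform 0 1 r s" "r\<^sup>2 - r * s + s\<^sup>2 = binform (-1) 1 r s"
    "r\<^sup>2 + r * s - s\<^sup>2 = binform 1 (-1) r s" for r s
    by (simp_all add: binform_def)
  have even: "\<And>p. inert b e p \<Longrightarrow> even (multiplicity p c)"
    if "\<exists>y r s. y \<noteq> 0 \<and> int c * y\<^sup>2 = binform b e r s" for b e
    using that even_multiplicity_of_binform[OF _ assms] by blast
  have iff: "(\<exists>r s. int c = binform b e r s) \<longleftrightarrow> (\<forall>p. inert b e p \<longrightarrow> even (multiplicity p c))"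
    if "(b, e) \<in> {(0, 1), (-1, 1), (1, -1)}" for b e
    using binform_iff_inert_even[OF that assms] .
  have of_form: "has_multiplier \<Lambda> (real c)"
    if "\<And>r s. has_multiplier \<Lambda> (of_int (binform b e r s))" "\<exists>r s. int c = binform b e r s"
    for b e and \<Lambda> :: "(real ^ 'n) set"
    using that by (metis of_int_of_nat_eq)
  \<comment> \<open>A cycle: a multiplier gives a representation of \<open>c\<close> times a square,
    hence even multiplicities at inert primes, hence a representation of \<open>c\<close>, hence a
    multiplier. The numbers 1 and 3 are half the dimensions.\<close>
  have Z2: "has_multiplier Z2_lattice (real c) \<longleftrightarrow> (\<exists>r s. int c = binform 0 1 r s)"
    using even[OF integer_lattice_binform[where 'n = 2, of c 1]] iff[of 0 1] of_form[OF Z2_multiplier] by auto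
  have Z6: "has_multiplier Z6_lattice (real c) \<longleftrightarrow> (\<exists>r s. int c = binform 0 1 r s)"
    using even[OF integer_lattice_binform[where 'n = 6, of c 3]] iff[of 0 1] of_form[OF Z6_multiplier] by auto
  have A2: "has_multiplier A2_lattice (real c) \<longleftrightarrow> (\<exists>r s. int c = binform (-1) 1 r s)"
    using even[OF A2_lattice_binform] iff[of "-1" 1] of_form[OF A2_multiplier] by auto
  have E6: "has_multiplier E6_lattice (real c) \<longleftrightarrow> (\<exists>r s. int c = binform (-1) 1 r s)"
    using even[OF E6_lattice_binform] iff[of "-1" 1] of_form[OF E6_multiplier] by auto
  \<comment> \<open>Here the multiplier is built from the even multiplicities, prime by prime, and
    not from a representation of \<open>c\<close>.\<close>
  have A4: "has_multiplier A4_lattice (real c) \<longleftrightarrow> (\<exists>r s. int c = binform 1 (-1) r s)"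
    using even[OF A4_lattice_binform] iff[of 1 "-1"] A4_multiplier[OF assms] by auto
  show ?thesis
    unfolding form Z2 Z6 A2 E6 A4
    using iff[of 0 1] iff[of "-1" 1] iff[of 1 "-1"]
    unfolding inert_gaussian_iff inert_eisenstein_iff inert_golden_iff by simp
qed

end
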